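(* Let $\Omega\subset\mathbb{R}^n$ be a bounded domain and let $L_M=L_M(\Omega)$ be a reflexive Orlicz space on $\Omega$ such that $\|\chi_E\|_{L_M}\to0$ as $|E|\to0$ (where $E\subset\Omega$ is measurable, $\chi_E$ is its characteristic function and $|E|$ its Lebesgue measure). Then $\overline{C_0^\infty(\Omega)}=G_M(\Omega)$, where the closure is taken in $L_M(\Omega)$.
   Context: $N$-function: a continuous convex even function $M:\mathbb{R}\to\mathbb{R}$ with $\lim_{u\to0}M(u)/u=0$ and $\lim_{u\to\infty}M(u)/u=\infty$; its complementary $N$-function is $N(v)=\max_{u\ge0}\{u|v|-M(u)\}$. Orlicz space: for an $N$-function $M$, with $\rho_N(v)=\int_\Omega N(v(x))dx$, $L_M(\Omega)$ is the space of measurable $u$ on $\Omega$ such that $\int_\Omega u\bar v\,dx$ is finite for every measurable $v$ with $\rho_N(v)<\infty$, with norm $\|u\|_M=\|u\|_{L_M}=\sup_{\rho_N(v)\le1}\left|\int_\Omega u\bar v\,dx\right|$. Shifts and $G_M$: let $d_\Omega$ be the diameter of $\Omega$ and $Q_d\supset\Omega$ a cube with sides of length $d_\Omega$ parallel to the axes. A function $f$ on $\Omega$ is extended by zero to $Q_d$ and then periodically, with period $d_\Omega$ in each variable, to $\mathbb{R}^n$; for $\delta\in\mathbb{R}^n$, $T_\delta f(x)=f(x+\delta)$ is the shift of this extension. $G_M(\Omega)=\{f\in L_M(\Omega):\|T_\delta f-f\|_M\to0\text{ as }\delta\to0\}$, with the norm $\|\cdot\|_M$. $C_0^\infty(\Omega)$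 is the set of infinitely differentiable functions with compact support in $\Omega$. *)

theory Defs
  imports "HOL-Analysis.Analysis"
begin

section \<open>Duality for spaces of complex functions\<close>

text \<open>
  A seminormed space is given by a set \<open>V\<close> of complex-valued functions on an arbitrary type, with
  the pointwise operations, and a seminorm \<open>p\<close> that is finite on \<open>V\<close>. Functions at distance 0 are
  not identified; a bounded functional takes the same value on both, so the dual spaces are
  those of the associated normed space. The dual is a set of complex functions again, hence
  the bidual is obtained by iteration.
\<close>

definition dual_space ::
  "('a \<Rightarrow> complex) set \<Rightarrow> (('a \<Rightarrow> complex) \<Rightarrow> ennreal) \<Rightarrow> (('a \<Rightarrow> complex) \<Rightarrow> complex) set" where
  "dual_space V p = {F.
     (\<forall>u\<in>V. \<forall>w\<in>V. F (\<lambda>x. u x + w x) = F u + F w) \<and>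
     (\<forall>c. \<forall>u\<in>V. F (\<lambda>x. c * u x) = c * F u) \<and>
     (\<exists>C::real. \<forall>u\<in>V. ennreal (cmod (F u)) \<le> ennreal C * p u)}"

definition dual_norm ::
  "('a \<Rightarrow> complex) set \<Rightarrow> (('a \<Rightarrow> complex) \<Rightarrow> ennreal) \<Rightarrow> (('a \<Rightarrow> complex) \<Rightarrow> complex) \<Rightarrow> ennreal" where
  "dual_norm V p F = (SUP u\<in>{u \<in> V. p u \<le> 1}. ennreal (cmod (F u)))"

text \<open>The canonical map into the bidual is onto.\<close>

definition reflexive_space :: "('a \<Rightarrow> complex) set \<Rightarrow> (('a \<Rightarrow> complex) \<Rightarrow> ennreal) \<Rightarrow> bool" where
  "reflexive_space V p \<longleftrightarrow>
     (\<forall>\<Phi> \<in> dual_space (dual_space V p) (dual_norm V p).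
        \<exists>u\<in>V. \<forall>F \<in> dual_space V p. \<Phi> F = F u)"

definition seminorm_closure ::
  "('a \<Rightarrow> complex) set \<Rightarrow> (('a \<Rightarrow> complex) \<Rightarrow> ennreal) \<Rightarrow> ('a \<Rightarrow> complex) set \<Rightarrow> ('a \<Rightarrow> complex) set" where
  "seminorm_closure V p A =
     {u \<in> V. \<forall>\<epsilon>::real. \<epsilon> > 0 \<longrightarrow> (\<exists>\<phi>\<in>A. p (\<lambda>x. u x - \<phi> x) < ennreal \<epsilon>)}"


section \<open>Orlicz spaces\<close>

definition N_function :: "(real \<Rightarrow> real) \<Rightarrow> bool" where
  "N_function M \<longleftrightarrow> continuous_on UNIV M \<and> convex_on UNIV M \<and> (\<forall>u. M (- u) = M u) \<and>
     ((\<lambda>u. M u / u) \<longlongrightarrow> 0) (at 0) \<and> filterlim (\<lambda>u. M u / u) at_top at_top"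

text \<open>For an N-function the supremum is a maximum.\<close>

definition complementary :: "(real \<Rightarrow> real) \<Rightarrow> real \<Rightarrow> real" where
  "complementary M v = (SUP u\<in>{0..}. u * \<bar>v\<bar> - M u)"

text \<open>
  Functions on \<open>\<Omega>\<close> are represented by total functions whose values off \<open>\<Omega>\<close> play no role.
  The functions are complex-valued; since N is even, \<open>N (v x)\<close> stands for \<open>N \<bar>v x\<bar>\<close>.
\<close>

definition modular :: "(real \<Rightarrow> real) \<Rightarrow> (real^'n) set \<Rightarrow> (real^'n \<Rightarrow> complex) \<Rightarrow> ennreal" where
  "modular N \<Omega> v = (\<integral>\<^sup>+x. ennreal (N (cmod (v x))) \<partial>lebesgue_on \<Omega>)"

definition orlicz_space :: "(real \<Rightarrow> real) \<Rightarrow> (real^'n) set \<Rightarrow> (real^'n \<Rightarrow> complex) set" where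
  "orlicz_space M \<Omega> = {u \<in> borel_measurable (lebesgue_on \<Omega>).
     \<forall>v \<in> borel_measurable (lebesgue_on \<Omega>). modular (complementary M) \<Omega> v < \<infinity> \<longrightarrow>
       integrable (lebesgue_on \<Omega>) (\<lambda>x. u x * cnj (v x))}"

text \<open>
  Only meaningful on the Orlicz space, where all the integrals exist (elsewhere a nonexistent
  Bochner integral counts as 0).
\<close>

definition orlicz_norm :: "(real \<Rightarrow> real) \<Rightarrow> (real^'n) set \<Rightarrow> (real^'n \<Rightarrow> complex) \<Rightarrow> ennreal" where
  "orlicz_norm M \<Omega> u =
     (SUP v \<in> {v \<in> borel_measurable (lebesgue_on \<Omega>). modular (complementary M) \<Omega> v \<le> 1}.
        ennreal (cmod (\<integral>x. u x * cnj (v x) \<partial>lebesgue_on \<Omega>)))"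


section \<open>Shifts\<close>

text \<open>
  \<open>a\<close> is the corner of the cube with least coordinates and \<open>d\<close> the side length. The argument of
  the zero extension of \<open>f\<close> is the representative of \<open>x\<close> modulo \<open>d\<close> (in each coordinate) in the
  half-open cube, so its boundary causes no ambiguity.
\<close>

definition periodic_extension ::
  "(real^'n) set \<Rightarrow> real^'n \<Rightarrow> real \<Rightarrow> (real^'n \<Rightarrow> complex) \<Rightarrow> real^'n \<Rightarrow> complex" where
  "periodic_extension \<Omega> a d f x =
     (let y = (\<chi> i. a $ i + d * frac ((x $ i - a $ i) / d)) in if y \<in> \<Omega> then f y else 0)"

definition shift ::
  "(real^'n) set \<Rightarrow> real^'n \<Rightarrow> real^'n \<Rightarrow> (real^'n \<Rightarrow> complex) \<Rightarrow> real^'n \<Rightarrow> complex" where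
  "shift \<Omega> a \<delta> f x = periodic_extension \<Omega> a (diameter \<Omega>) f (x + \<delta>)"

definition G_space ::
  "(real \<Rightarrow> real) \<Rightarrow> (real^'n) set \<Rightarrow> real^'n \<Rightarrow> (real^'n \<Rightarrow> complex) set" where
  "G_space M \<Omega> a = {f \<in> orlicz_space M \<Omega>.
     ((\<lambda>\<delta>. orlicz_norm M \<Omega> (\<lambda>x. shift \<Omega> a \<delta> f x - f x)) \<longlongrightarrow> 0) (at 0)}"


section \<open>Test functions\<close>

primrec times_differentiable ::
  "nat \<Rightarrow> ('a::real_normed_vector \<Rightarrow> 'b::real_normed_vector) \<Rightarrow> bool" where
  "times_differentiable 0 f \<longleftrightarrow> continuous_on UNIV f"
| "times_differentiable (Suc k) f \<longleftrightarrow> (\<forall>x. f differentiable (at x)) \<and>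
     (\<forall>h. times_differentiable k (\<lambda>x. frechet_derivative f (at x) h))"

text \<open>Test functions on \<open>\<Omega>\<close> are extended by zero to the whole space.\<close>

definition test_functions :: "(real^'n) set \<Rightarrow> (real^'n \<Rightarrow> complex) set" where
  "test_functions \<Omega> = {f. (\<forall>k. times_differentiable k f) \<and>
     compact (closure {x. f x \<noteq> 0}) \<and> closure {x. f x \<noteq> 0} \<subseteq> \<Omega>}"

end

theory Submission
  imports Defs
begin

text \<open>
  Translation modulo the periods preserves Lebesgue measure on the half-open cube, so shifts do
  not increase the Orlicz norm, and the functions with continuous shifts form a closed set; it
  contains the test functions by uniform continuity.

  Conversely, if the shifts of \<open>f\<close> are continuous, the averages of \<open>T\<^sub>\<delta> f\<close> over small sets of
  vectors \<open>\<delta>\<close> converge to \<open>f\<close> in norm (by Fubini applied to the integrals against the functions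
  \<open>v\<close> that define the norm), and these averages are bounded. Bounded functions are uniform limits
  of linear combinations of indicators, and an indicator is approximated by a smooth function that
  differs substantially from it only on a set of small measure, hence of small norm.
\<close>

section \<open>The complementary function\<close>

text \<open>The norm is a supremum over test functions \<open>v\<close>, and this decides the
  method. Every estimate for a shift is obtained by moving the shift onto \<open>v\<close>, so the
  only fact needed about shifts is that they do not increase the modular of \<open>v\<close>.
  Averaging and smoothing are separate tasks. The averages supply bounded functions only: they need
  be neither smooth nor supported away from the boundary. Smoothness and compact support come from
  the second approximation, where the hypothesis on indicators controls the error sets, both around
  the level sets and near the boundary of the domain. No mollifier and no differentiation under an
  integral occurs; the smooth functions are explicit. The obstacle in the averaging step is
  measurability. Fubini needs joint measurability in the point and the shift vector, which does not
  follow from Lebesgue measurability of \<open>f\<close>. The averages are therefore formed from a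
  Borel representative of \<open>f\<close>.\<close>

context
  fixes M :: "real \<Rightarrow> real"
  assumes M: "N_function M"
begin

lemma N_function_zero: "M 0 = 0"
proof -
  have "(\<lambda>u. M u / u * u) \<midarrow>0\<rightarrow> 0 * 0"
    using M unfolding N_function_def by (intro tendsto_intros) auto
  then have "M \<midarrow>0\<rightarrow> 0"
    using Lim_transform_within_open[of _ "0 * 0" 0 UNIV UNIV M] by simp
  moreover have "M \<midarrow>0\<rightarrow> M 0"
    using M by (auto simp: N_function_def continuous_on_eq_continuous_at isCont_def)
  ultimately show ?thesis
    using LIM_unique by blast
qed

text \<open>Convexity at 0, the midpoint of \<open>u\<close> and \<open>- u\<close>, where evenness
  makes the two end values equal.\<close>

lemma N_function_nonneg: "M u \<ge> 0"
proof -
  have "convex_on UNIV M" and ev: "M (- u) = M u"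
    using M by (auto simp: N_function_def)
  then have "M ((1 - 1/2) *\<^sub>R u + (1/2) *\<^sub>R (- u)) \<le> (1 - 1/2) * M u + (1/2) * M (- u)"
    by (intro convex_onD) auto
  then show ?thesis
    by (simp add: N_function_zero ev)
qed

text \<open>Superlinear growth makes the expression nonpositive beyond some \<open>u0\<close>; below
  it, \<open>M \<ge> 0\<close> leaves at most \<open>u0 * \<bar>v\<bar>\<close>. Without boundedness
  the real supremum in \<open>complementary\<close> would carry no information.\<close>

lemma complementary_bdd_above: "bdd_above ((\<lambda>u. u * \<bar>v\<bar> - M u) ` {0..})"
proof -
  have "eventually (\<lambda>u. M u / u \<ge> \<bar>v\<bar>) at_top"
    using M by (auto simp: N_function_def filterlim_at_top)
  then have "eventually (\<lambda>u. M u / u \<ge> \<bar>v\<bar> \<and> u > 0) at_top"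
    using eventually_gt_at_top[of 0] by eventually_elim auto
  then obtain u0 where u0: "M u / u \<ge> \<bar>v\<bar>" "u > 0" if "u \<ge> u0" for u
    by (auto simp: eventually_at_top_linorder)
  have "u * \<bar>v\<bar> - M u \<le> max 0 (u0 * \<bar>v\<bar>)" if "u \<ge> 0" for u
  proof (cases "u \<ge> u0")
    case True
    then show ?thesis
      using u0[of u] by (auto simp: field_simps)
  next
    case False
    then have "u * \<bar>v\<bar> \<le> u0 * \<bar>v\<bar>"
      by (intro mult_right_mono) auto
    then show ?thesis
      using N_function_nonneg[of u] by linarith
  qed
  then show ?thesis
    by (auto simp: bdd_above_def)
qed

lemma Young_inequality: "u \<ge> 0 \<Longrightarrow> v \<ge> 0 \<Longrightarrow> u * v \<le> M u + complementary M v"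
  using cSUP_upper[OF _ complementary_bdd_above[of v], of u]
  by (auto simp: complementary_def)

lemma complementary_nonneg: "complementary M v \<ge> 0"
  using cSUP_upper[OF _ complementary_bdd_above[of v], of 0]
  by (auto simp: complementary_def N_function_zero)

lemma complementary_zero: "complementary M 0 = 0"
proof (rule antisym)
  show "complementary M 0 \<le> 0"
    unfolding complementary_def by (rule cSUP_least) (auto simp: N_function_nonneg)
qed (rule complementary_nonneg)

lemma complementary_mono: "\<bar>s\<bar> \<le> \<bar>t\<bar> \<Longrightarrow> complementary M s \<le> complementary M t"
  unfolding complementary_def
  by (rule cSUP_mono[OF _ complementary_bdd_above]) (auto intro!: bexI[of _ n for n] mult_left_mono)

lemma borel_measurable_complementary: "complementary M \<in> borel_measurable borel"
proof -
  \<comment> \<open>The function increases only on the nonnegative half line. Cutting off at 0 gives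
    a function monotone on the whole line, and evenness recovers the original.\<close>
  have "(\<lambda>t. complementary M (max 0 t)) \<in> borel_measurable borel"
    by (rule borel_measurable_mono) (auto simp: mono_def intro!: complementary_mono)
  then have "(\<lambda>t. complementary M (max 0 \<bar>t\<bar>)) \<in> borel_measurable borel"
    by measurable
  moreover have "(\<lambda>t. complementary M (max 0 \<bar>t\<bar>)) = complementary M"
    by (simp add: complementary_def fun_eq_iff)
  ultimately show ?thesis
    by simp
qed

end

section \<open>The Orlicz norm in terms of absolute values\<close>

text \<open>
  On the Orlicz space this agrees with the Orlicz norm, since the phase of the test function
  can be adapted. Being built from nonnegative integrals only, it is monotone and subadditive
  without any integrability side condition (a nonexistent Bochner integral counts as 0).
\<close>

definition abs_orlicz_norm :: "(real \<Rightarrow> real) \<Rightarrow> (real^'n) set \<Rightarrow> (real^'n \<Rightarrow> complex) \<Rightarrow> ennreal" where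
  "abs_orlicz_norm M \<Omega> u =
     (SUP v \<in> {v \<in> borel_measurable (lebesgue_on \<Omega>). modular (complementary M) \<Omega> v \<le> 1}.
        \<integral>\<^sup>+x. ennreal (cmod (u x) * cmod (v x)) \<partial>lebesgue_on \<Omega>)"

lemma abs_orlicz_norm_upper:
  assumes "v \<in> borel_measurable (lebesgue_on \<Omega>)" "modular (complementary M) \<Omega> v \<le> 1"
  shows "(\<integral>\<^sup>+x. ennreal (cmod (u x) * cmod (v x)) \<partial>lebesgue_on \<Omega>) \<le> abs_orlicz_norm M \<Omega> u"
  unfolding abs_orlicz_norm_def by (rule SUP_upper) (use assms in auto)

lemma abs_orlicz_norm_least:
  assumes "\<And>v. v \<in> borel_measurable (lebesgue_on \<Omega>) \<Longrightarrow> modular (complementary M) \<Omega> v \<le> 1 \<Longrightarrow>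
    (\<integral>\<^sup>+x. ennreal (cmod (u x) * cmod (v x)) \<partial>lebesgue_on \<Omega>) \<le> c"
  shows "abs_orlicz_norm M \<Omega> u \<le> c"
  unfolding abs_orlicz_norm_def by (rule SUP_least) (use assms in auto)

text \<open>Valid for every \<open>u\<close>: where the Bochner integral does not exist, its value 0
  makes the bound trivial.\<close>

lemma orlicz_norm_le_abs: "orlicz_norm M \<Omega> u \<le> abs_orlicz_norm M \<Omega> u"
  unfolding orlicz_norm_def
proof (rule SUP_least, safe)
  fix v :: "real^'a \<Rightarrow> complex"
  assume v: "v \<in> borel_measurable (lebesgue_on \<Omega>)" "modular (complementary M) \<Omega> v \<le> 1"
  have "ennreal (cmod (\<integral>x. u x * cnj (v x) \<partial>lebesgue_on \<Omega>))
      \<le> (\<integral>\<^sup>+x. ennreal (norm (u x * cnj (v x))) \<partial>lebesgue_on \<Omega>)"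
  proof (cases "integrable (lebesgue_on \<Omega>) (\<lambda>x. u x * cnj (v x))")
    case True
    then show ?thesis
      by (rule integral_norm_bound_ennreal)
  next
    case False
    then show ?thesis
      by (simp add: not_integrable_integral_eq)
  qed
  also have "\<dots> \<le> abs_orlicz_norm M \<Omega> u"
    using abs_orlicz_norm_upper[OF v] by (simp add: norm_mult)
  finally show "ennreal (cmod (\<integral>x. u x * cnj (v x) \<partial>lebesgue_on \<Omega>)) \<le> abs_orlicz_norm M \<Omega> u" .
qed

lemma borel_measurable_cnj [measurable]:
  "f \<in> borel_measurable N \<Longrightarrow> (\<lambda>x. cnj (f x)) \<in> borel_measurable N"
  by (rule measurable_compose[OF _ borel_measurable_continuous_onI]) (auto intro: continuous_intros)

text \<open>Integrability is measurability together with a finite integral of the modulus, and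
  conjugation does not change the modulus. Membership can thus be treated with nonnegative integrals
  alone.\<close>

lemma orlicz_space_iff:
  "u \<in> orlicz_space M \<Omega> \<longleftrightarrow> u \<in> borel_measurable (lebesgue_on \<Omega>) \<and>
     (\<forall>v\<in>borel_measurable (lebesgue_on \<Omega>). modular (complementary M) \<Omega> v < \<infinity> \<longrightarrow>
       (\<integral>\<^sup>+x. ennreal (cmod (u x) * cmod (v x)) \<partial>lebesgue_on \<Omega>) < \<infinity>)"
  unfolding orlicz_space_def
  by (auto simp: integrable_iff_bounded norm_mult intro!: borel_measurable_times borel_measurable_cnj)

lemma abs_orlicz_norm_eq:
  assumes u: "u \<in> orlicz_space M \<Omega>"
  shows "abs_orlicz_norm M \<Omega> u = orlicz_norm M \<Omega> u"
proof (rule antisym[OF abs_orlicz_norm_least orlicz_norm_le_abs])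
  fix v :: "real^'a \<Rightarrow> complex"
  assume v[measurable]: "v \<in> borel_measurable (lebesgue_on \<Omega>)"
    and mod: "modular (complementary M) \<Omega> v \<le> 1"
  have [measurable]: "u \<in> borel_measurable (lebesgue_on \<Omega>)"
    using u by (simp add: orlicz_space_def)
  \<comment> \<open>The modulus of \<open>v\<close> with the phase of \<open>u\<close>, so that
    \<open>u x * cnj (w x)\<close> is real and nonnegative. The value 1 where \<open>u\<close>
    vanishes keeps \<open>cmod (w x) = cmod (v x)\<close> everywhere, hence the same
    modular.\<close>
  define w where "w x = complex_of_real (cmod (v x)) * (if u x = 0 then 1 else sgn (u x))" for x
  have [measurable]: "w \<in> borel_measurable (lebesgue_on \<Omega>)"
    unfolding w_def sgn_div_norm by measurable
  have cmod_w: "cmod (w x) = cmod (v x)" for x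
    by (simp add: w_def norm_mult norm_sgn)
  have "modular (complementary M) \<Omega> w \<le> 1"
    using mod by (simp add: modular_def cmod_w)
  moreover from this have "modular (complementary M) \<Omega> w < \<infinity>"
    by (rule le_less_trans) simp
  ultimately have int: "integrable (lebesgue_on \<Omega>) (\<lambda>x. u x * cnj (w x))"
    and le: "ennreal (cmod (\<integral>x. u x * cnj (w x) \<partial>lebesgue_on \<Omega>)) \<le> orlicz_norm M \<Omega> u"
    using u unfolding orlicz_space_def orlicz_norm_def by (auto intro!: SUP_upper2[of w])
  have uw: "u x * cnj (w x) = complex_of_real (cmod (u x) * cmod (v x))" for x
  proof -
    have "u x * cnj (sgn (u x)) = complex_of_real (cmod (u x))"
      by (cases "u x = 0")
         (simp_all add: sgn_eq complex_norm_square[symmetric] power2_eq_square)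
    then show ?thesis
      by (simp add: w_def)
  qed
  have int': "integrable (lebesgue_on \<Omega>) (\<lambda>x. cmod (u x) * cmod (v x))"
    using int unfolding uw by (simp only: complex_of_real_integrable_eq)
  have "(\<integral>\<^sup>+x. ennreal (cmod (u x) * cmod (v x)) \<partial>lebesgue_on \<Omega>)
     = ennreal (\<integral>x. cmod (u x) * cmod (v x) \<partial>lebesgue_on \<Omega>)"
    by (intro nn_integral_eq_integral int') auto
  also have "\<dots> = ennreal (cmod (\<integral>x. u x * cnj (w x) \<partial>lebesgue_on \<Omega>))"
    unfolding uw by (subst integral_complex_of_real) (simp add: integral_nonneg_AE del: of_real_mult)
  finally show "(\<integral>\<^sup>+x. ennreal (cmod (u x) * cmod (v x)) \<partial>lebesgue_on \<Omega>) \<le> orlicz_norm M \<Omega> u"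
    using le by simp
qed

lemma abs_orlicz_norm_mono:
  assumes "\<And>x. x \<in> \<Omega> \<Longrightarrow> cmod (u x) \<le> cmod (w x)"
  shows "abs_orlicz_norm M \<Omega> u \<le> abs_orlicz_norm M \<Omega> w"
  unfolding abs_orlicz_norm_def
  by (rule SUP_mono', rule nn_integral_mono)
     (auto simp: space_restrict_space intro!: ennreal_leI mult_right_mono assms)

text \<open>Domination in place of an equation lets one lemma serve sums, differences and triangle
  inequalities through a third function.\<close>

lemma abs_orlicz_norm_add:
  assumes [measurable]: "u \<in> borel_measurable (lebesgue_on \<Omega>)" "w \<in> borel_measurable (lebesgue_on \<Omega>)"
    and le: "\<And>x. x \<in> \<Omega> \<Longrightarrow> cmod (f x) \<le> cmod (u x) + cmod (w x)"
  shows "abs_orlicz_norm M \<Omega> f \<le> abs_orlicz_norm M \<Omega> u + abs_orlicz_norm M \<Omega> w"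
proof (rule abs_orlicz_norm_least)
  fix v :: "real^'a \<Rightarrow> complex"
  assume v: "v \<in> borel_measurable (lebesgue_on \<Omega>)" "modular (complementary M) \<Omega> v \<le> 1"
  note [measurable] = v(1)
  have "(\<integral>\<^sup>+x. ennreal (cmod (f x) * cmod (v x)) \<partial>lebesgue_on \<Omega>)
     \<le> (\<integral>\<^sup>+x. ennreal (cmod (u x) * cmod (v x)) + ennreal (cmod (w x) * cmod (v x)) \<partial>lebesgue_on \<Omega>)"
    by (rule nn_integral_mono)
       (auto simp: space_restrict_space simp flip: ennreal_plus distrib_right
             intro!: ennreal_leI mult_right_mono le)
  also have "\<dots> = (\<integral>\<^sup>+x. ennreal (cmod (u x) * cmod (v x)) \<partial>lebesgue_on \<Omega>)
      + (\<integral>\<^sup>+x. ennreal (cmod (w x) * cmod (v x)) \<partial>lebesgue_on \<Omega>)"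
    by (rule nn_integral_add) auto
  also have "\<dots> \<le> abs_orlicz_norm M \<Omega> u + abs_orlicz_norm M \<Omega> w"
    by (intro add_mono abs_orlicz_norm_upper v)
  finally show "(\<integral>\<^sup>+x. ennreal (cmod (f x) * cmod (v x)) \<partial>lebesgue_on \<Omega>) \<le> \<dots>" .
qed

lemma abs_orlicz_norm_scale:
  assumes [measurable]: "u \<in> borel_measurable (lebesgue_on \<Omega>)"
  shows "abs_orlicz_norm M \<Omega> (\<lambda>x. c * u x) \<le> ennreal (cmod c) * abs_orlicz_norm M \<Omega> u"
proof (rule abs_orlicz_norm_least)
  fix v :: "real^'a \<Rightarrow> complex"
  assume v: "v \<in> borel_measurable (lebesgue_on \<Omega>)" "modular (complementary M) \<Omega> v \<le> 1"
  note [measurable] = v(1)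
  have "(\<integral>\<^sup>+x. ennreal (cmod (c * u x) * cmod (v x)) \<partial>lebesgue_on \<Omega>)
      = (\<integral>\<^sup>+x. ennreal (cmod c) * ennreal (cmod (u x) * cmod (v x)) \<partial>lebesgue_on \<Omega>)"
    by (simp add: norm_mult mult_ac flip: ennreal_mult)
  also have "\<dots> = ennreal (cmod c) * (\<integral>\<^sup>+x. ennreal (cmod (u x) * cmod (v x)) \<partial>lebesgue_on \<Omega>)"
    by (rule nn_integral_cmult) measurable
  also have "\<dots> \<le> ennreal (cmod c) * abs_orlicz_norm M \<Omega> u"
    by (intro mult_left_mono abs_orlicz_norm_upper v) auto
  finally show "(\<integral>\<^sup>+x. ennreal (cmod (c * u x) * cmod (v x)) \<partial>lebesgue_on \<Omega>) \<le> \<dots>" .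
qed

lemma abs_orlicz_norm_AE_zero:
  assumes "AE x in lebesgue_on \<Omega>. u x = 0"
  shows "abs_orlicz_norm M \<Omega> u = 0"
proof -
  have "(\<integral>\<^sup>+x. ennreal (cmod (u x) * cmod (v x)) \<partial>lebesgue_on \<Omega>) = (\<integral>\<^sup>+x. 0 \<partial>lebesgue_on \<Omega>)" for v
    by (rule nn_integral_cong_AE) (use assms in eventually_elim, simp)
  then have "abs_orlicz_norm M \<Omega> u \<le> 0"
    by (intro abs_orlicz_norm_least) simp
  then show ?thesis
    by simp
qed

lemma orlicz_space_dominated:
  assumes "u \<in> orlicz_space M \<Omega>" "w \<in> orlicz_space M \<Omega>" "f \<in> borel_measurable (lebesgue_on \<Omega>)"
    and le: "\<And>x. x \<in> \<Omega> \<Longrightarrow> cmod (f x) \<le> cmod (u x) + cmod (w x)"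
  shows "f \<in> orlicz_space M \<Omega>"
  unfolding orlicz_space_iff
proof (intro conjI ballI impI)
  fix v :: "real^'a \<Rightarrow> complex"
  assume v[measurable]: "v \<in> borel_measurable (lebesgue_on \<Omega>)" and mod: "modular (complementary M) \<Omega> v < \<infinity>"
  have [measurable]: "u \<in> borel_measurable (lebesgue_on \<Omega>)" "w \<in> borel_measurable (lebesgue_on \<Omega>)"
    using assms by (auto simp: orlicz_space_iff)
  have "(\<integral>\<^sup>+x. ennreal (cmod (f x) * cmod (v x)) \<partial>lebesgue_on \<Omega>)
     \<le> (\<integral>\<^sup>+x. ennreal (cmod (u x) * cmod (v x)) + ennreal (cmod (w x) * cmod (v x)) \<partial>lebesgue_on \<Omega>)"
    by (rule nn_integral_mono)
       (auto simp: space_restrict_space simp flip: ennreal_plus distrib_right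
             intro!: ennreal_leI mult_right_mono le)
  also have "\<dots> = (\<integral>\<^sup>+x. ennreal (cmod (u x) * cmod (v x)) \<partial>lebesgue_on \<Omega>)
      + (\<integral>\<^sup>+x. ennreal (cmod (w x) * cmod (v x)) \<partial>lebesgue_on \<Omega>)"
    by (rule nn_integral_add) auto
  also have "\<dots> < \<infinity>"
    using assms(1,2) v mod by (auto simp: orlicz_space_iff ennreal_add_eq_top less_top[symmetric])
  finally show "(\<integral>\<^sup>+x. ennreal (cmod (f x) * cmod (v x)) \<partial>lebesgue_on \<Omega>) < \<infinity>" .
qed (use assms in auto)

lemma orlicz_space_diff:
  assumes u: "u \<in> orlicz_space M \<Omega>" and w: "w \<in> orlicz_space M \<Omega>"
  shows "(\<lambda>x. u x - w x) \<in> orlicz_space M \<Omega>"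
proof (rule orlicz_space_dominated[OF u w])
  have [measurable]: "u \<in> borel_measurable (lebesgue_on \<Omega>)" "w \<in> borel_measurable (lebesgue_on \<Omega>)"
    using assms by (auto simp: orlicz_space_iff)
  show "(\<lambda>x. u x - w x) \<in> borel_measurable (lebesgue_on \<Omega>)"
    by measurable
qed (rule norm_triangle_ineq4)

lemma emeasure_lebesgue_on_finite: "S \<in> lmeasurable \<Longrightarrow> emeasure (lebesgue_on S) S < \<infinity>"
  by (simp add: emeasure_restrict_space fmeasurable_def del: emeasure_completion)

section \<open>Bounded functions over a domain of finite measure\<close>

context
  fixes M :: "real \<Rightarrow> real" and \<Omega> :: "(real^'n) set"
  assumes M: "N_function M" and \<Omega>: "\<Omega> \<in> lmeasurable"
begin

lemma modular_one_finite: "modular (complementary M) \<Omega> (\<lambda>x. 1) < \<infinity>"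
  using emeasure_lebesgue_on_finite[OF \<Omega>]
  by (simp add: modular_def space_restrict_space ennreal_mult_less_top)

lemma nn_integral_orlicz_space_finite:
  assumes "u \<in> orlicz_space M \<Omega>"
  shows "(\<integral>\<^sup>+x. ennreal (cmod (u x)) \<partial>lebesgue_on \<Omega>) < \<infinity>"
proof -
  have "(\<lambda>x. 1 :: complex) \<in> borel_measurable (lebesgue_on \<Omega>)"
    by simp
  with assms modular_one_finite have
    "(\<integral>\<^sup>+x. ennreal (cmod (u x) * cmod 1) \<partial>lebesgue_on \<Omega>) < \<infinity>"
    unfolding orlicz_space_iff by blast
  then show ?thesis
    by simp
qed

text \<open>Young's inequality with first factor 1. It is the source of the finite norm of the
  constant 1 and of the membership of bounded functions in the Orlicz space.\<close>

lemma nn_integral_le_modular: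
  assumes [measurable]: "v \<in> borel_measurable (lebesgue_on \<Omega>)"
  shows "(\<integral>\<^sup>+x. ennreal (cmod (v x)) \<partial>lebesgue_on \<Omega>)
    \<le> ennreal (M 1) * emeasure (lebesgue_on \<Omega>) \<Omega> + modular (complementary M) \<Omega> v"
proof -
  note [measurable] = borel_measurable_complementary[OF M]
  have "cmod (v x) \<le> M 1 + complementary M (cmod (v x))" for x
    using Young_inequality[OF M, of 1 "cmod (v x)"] by simp
  then have "(\<integral>\<^sup>+x. ennreal (cmod (v x)) \<partial>lebesgue_on \<Omega>)
      \<le> (\<integral>\<^sup>+x. ennreal (M 1) + ennreal (complementary M (cmod (v x))) \<partial>lebesgue_on \<Omega>)"
    by (intro nn_integral_mono)
       (simp add: N_function_nonneg[OF M] complementary_nonneg[OF M] flip: ennreal_plus)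
  also have "\<dots> = (\<integral>\<^sup>+x. ennreal (M 1) \<partial>lebesgue_on \<Omega>) + modular (complementary M) \<Omega> v"
    unfolding modular_def by (rule nn_integral_add) measurable
  finally show ?thesis
    by (simp add: space_restrict_space)
qed

lemma abs_orlicz_norm_one_finite: "abs_orlicz_norm M \<Omega> (\<lambda>x. 1) < \<infinity>"
proof -
  have "abs_orlicz_norm M \<Omega> (\<lambda>x. 1) \<le> ennreal (M 1) * emeasure (lebesgue_on \<Omega>) \<Omega> + 1"
    by (rule abs_orlicz_norm_least)
       (use nn_integral_le_modular add_left_mono in \<open>fastforce intro: order_trans\<close>)
  also have "\<dots> < \<infinity>"
    using emeasure_lebesgue_on_finite[OF \<Omega>] by (simp add: ennreal_mult_less_top)
  finally show ?thesis .
qed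

lemma bounded_in_orlicz_space:
  assumes [measurable]: "f \<in> borel_measurable (lebesgue_on \<Omega>)" and B: "\<And>x. x \<in> \<Omega> \<Longrightarrow> cmod (f x) \<le> B"
  shows "f \<in> orlicz_space M \<Omega>"
  unfolding orlicz_space_iff
proof (intro conjI ballI impI)
  fix v :: "real^'n \<Rightarrow> complex"
  assume v[measurable]: "v \<in> borel_measurable (lebesgue_on \<Omega>)" and mod: "modular (complementary M) \<Omega> v < \<infinity>"
  have "(\<integral>\<^sup>+x. ennreal (cmod (f x) * cmod (v x)) \<partial>lebesgue_on \<Omega>)
      \<le> (\<integral>\<^sup>+x. ennreal (max 0 B) * ennreal (cmod (v x)) \<partial>lebesgue_on \<Omega>)"
    using B by (intro nn_integral_mono)
       (force simp: space_restrict_space simp flip: ennreal_mult intro!: ennreal_leI mult_right_mono)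
  also have "\<dots> = ennreal (max 0 B) * (\<integral>\<^sup>+x. ennreal (cmod (v x)) \<partial>lebesgue_on \<Omega>)"
    by (rule nn_integral_cmult) measurable
  also have "\<dots> < \<infinity>"
    using le_less_trans[OF nn_integral_le_modular[OF v], of \<infinity>] mod emeasure_lebesgue_on_finite[OF \<Omega>]
    by (auto simp: ennreal_mult_less_top)
  finally show "(\<integral>\<^sup>+x. ennreal (cmod (f x) * cmod (v x)) \<partial>lebesgue_on \<Omega>) < \<infinity>" .
qed fact

lemma abs_orlicz_norm_le_sup:
  assumes B: "\<And>x. x \<in> \<Omega> \<Longrightarrow> cmod (f x) \<le> B" "B \<ge> 0"
  shows "abs_orlicz_norm M \<Omega> f \<le> ennreal (B * enn2real (abs_orlicz_norm M \<Omega> (\<lambda>x. 1)))"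
proof -
  have "abs_orlicz_norm M \<Omega> f \<le> abs_orlicz_norm M \<Omega> (\<lambda>x. complex_of_real B * 1)"
    using B by (intro abs_orlicz_norm_mono) auto
  also have "\<dots> \<le> ennreal B * abs_orlicz_norm M \<Omega> (\<lambda>x. 1)"
    using abs_orlicz_norm_scale[of "\<lambda>x. 1" \<Omega> M "complex_of_real B"] B by simp
  also have "\<dots> = ennreal (B * enn2real (abs_orlicz_norm M \<Omega> (\<lambda>x. 1)))"
    using B abs_orlicz_norm_one_finite by (simp add: ennreal_mult)
  finally show ?thesis .
qed

end

section \<open>Translations modulo the lattice of periods\<close>

text \<open>The reduction modulo the periods, isolated from \<open>periodic_extension\<close>: a
  shift becomes composition with a map of the cell into itself.\<close>

definition wrap :: "real^'n \<Rightarrow> real \<Rightarrow> real^'n \<Rightarrow> real^'n" where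
  "wrap a d x = (\<chi> i. a $ i + d * frac ((x $ i - a $ i) / d))"

text \<open>Half-open, so that it is an exact fundamental domain of the lattice: each point has one
  and only one representative in it.\<close>

definition cell :: "real^'n \<Rightarrow> real \<Rightarrow> (real^'n) set" where
  "cell a d = {x. \<forall>i. a $ i \<le> x $ i \<and> x $ i < a $ i + d}"

definition lattice_point :: "real \<Rightarrow> int^'n \<Rightarrow> real^'n" where
  "lattice_point d k = (\<chi> i. d * of_int (k $ i))"

lemma borel_measurable_wrap [measurable]:
  assumes [measurable]: "f \<in> borel_measurable N"
  shows "(\<lambda>x. wrap a d (f x)) \<in> borel_measurable N"
proof -
  have "(\<lambda>x. wrap a d (f x) \<bullet> b) \<in> borel_measurable N" if bB: "b \<in> Basis" for b
  proof -
    obtain i where b: "b = axis i 1"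
      using bB by (auto simp: Basis_vec_def)
    have "(\<lambda>x. f x \<bullet> axis i 1) \<in> borel_measurable N"
      by measurable
    then have [measurable]: "(\<lambda>x. f x $ i) \<in> borel_measurable N"
      by (simp add: inner_axis)
    show ?thesis
      unfolding b inner_axis wrap_def frac_def by simp
  qed
  then show ?thesis
    by (subst borel_measurable_euclidean_space) blast
qed

lemma cell_borel [measurable]: "cell a d \<in> sets borel"
proof -
  have "cell a d = (\<Inter>i. {x. a $ i \<le> x $ i} \<inter> {x. x $ i < a $ i + d})"
    by (auto simp: cell_def)
  moreover have "closed {x::real^'a. a $ i \<le> x $ i}" "open {x::real^'a. x $ i < a $ i + d}" for i
    by (auto intro!: closed_Collect_le open_Collect_less continuous_intros)
  ultimately show ?thesis
    by (auto intro!: sets.finite_INT)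
qed

lemma cell_subset_cbox: "cell a d \<subseteq> cbox a (a + vec d)"
  by (auto simp: cell_def mem_box_cart less_imp_le)

context
  fixes a :: "real^'n" and d :: real
  assumes d: "d > 0"
begin

lemma wrap_in_cell: "wrap a d x \<in> cell a d"
  using d by (auto simp: wrap_def cell_def frac_lt_1)

lemma wrap_cell: "x \<in> cell a d \<Longrightarrow> wrap a d x = x"
  using d by (auto simp: wrap_def cell_def vec_eq_iff frac_eq[THEN iffD2] field_simps)

lemma wrap_eq_minus_lattice_point: "\<exists>k. wrap a d x = x - lattice_point d k"
  using d
  by (intro exI[of _ "\<chi> i. \<lfloor>(x $ i - a $ i) / d\<rfloor>"])
     (auto simp: wrap_def lattice_point_def vec_eq_iff frac_def field_simps)

lemma wrap_minus_lattice_point: "wrap a d (x - lattice_point d k) = wrap a d x"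
proof -
  have "(x $ i - d * of_int (k $ i) - a $ i) / d = (x $ i - a $ i) / d - of_int (k $ i)" for i
    using d by (simp add: field_simps)
  then show ?thesis
    by (simp add: wrap_def lattice_point_def vec_eq_iff frac_def)
qed

text \<open>The inner reduction subtracts a lattice vector, which the outer one does not see. Hence
  translations modulo the lattice compose, and the one by \<open>- y\<close> undoes the one by
  \<open>y\<close> on the cell.\<close>

lemma wrap_wrap_add: "wrap a d (wrap a d x + y) = wrap a d (x + y)"
proof -
  obtain k where "wrap a d x = x - lattice_point d k"
    using wrap_eq_minus_lattice_point by blast
  then have "wrap a d x + y = (x + y) - lattice_point d k"
    by simp
  then show ?thesis
    by (simp only: wrap_minus_lattice_point)
qed

lemma inj_lattice_point: "lattice_point d k = lattice_point d l \<longleftrightarrow> k = l"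
  using d by (auto simp: lattice_point_def vec_eq_iff)

text \<open>Both points are fixed by \<open>wrap\<close>, which ignores lattice vectors, so both
  equal \<open>wrap a d x\<close>.\<close>

lemma minus_lattice_point_in_cell_unique:
  assumes "x - lattice_point d k \<in> cell a d" "x - lattice_point d l \<in> cell a d"
  shows "k = l"
proof -
  have "x - lattice_point d k = x - lattice_point d l"
    using wrap_cell[OF assms(1)] wrap_cell[OF assms(2)] by (simp add: wrap_minus_lattice_point)
  then show ?thesis
    by (simp add: inj_lattice_point)
qed

text \<open>
  Both the cell and its translate are fundamental domains, so the pieces into which the lattice
  cuts one of them reassemble to the other.
\<close>

lemma wrap_translation_vimage:
  assumes A: "A \<in> sets lebesgue" "A \<subseteq> cell a d"
  shows "{x \<in> cell a d. wrap a d (x + \<delta>) \<in> A} \<in> sets lebesgue" (is "?B \<in> _")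
    and "emeasure lebesgue {x \<in> cell a d. wrap a d (x + \<delta>) \<in> A} = emeasure lebesgue A"
proof -
  let ?s = "\<lambda>k. lattice_point d k - \<delta>"
  \<comment> \<open>\<open>?D k\<close> consists of the points of \<open>A\<close> that translation
    by \<open>?s k\<close> brings back into the cell. These translated pieces make up the
    preimage.\<close>
  let ?D = "\<lambda>k. A \<inter> (+) (- ?s k) ` cell a d"
  have cell: "cell a d \<in> sets lebesgue"
    by simp
  have im: "x \<in> (+) c ` S \<longleftrightarrow> x - c \<in> S" for c x :: "real^'n" and S
    by (auto simp: image_iff intro!: bexI[of _ "x - c"])
  have D: "?D k \<in> sets lebesgue" for k
    by (intro sets.Int A lebesgue_sets_translation cell)
  have B_eq: "?B = (\<Union>k. (+) (?s k) ` ?D k)"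
  proof (intro subset_antisym subsetI)
    fix x assume "x \<in> ?B"
    then have x: "x \<in> cell a d" "wrap a d (x + \<delta>) \<in> A"
      by auto
    obtain k where "wrap a d (x + \<delta>) = x + \<delta> - lattice_point d k"
      using wrap_eq_minus_lattice_point by blast
    moreover from this have "x = ?s k + wrap a d (x + \<delta>)"
      by simp
    moreover have "wrap a d (x + \<delta>) \<in> ?D k"
      using x calculation(1) by (auto simp: im)
    ultimately show "x \<in> (\<Union>k. (+) (?s k) ` ?D k)"
      by blast
  next
    fix y assume "y \<in> (\<Union>k. (+) (?s k) ` ?D k)"
    then obtain k x where y: "y = ?s k + x" and x: "x \<in> A" "x \<in> (+) (- ?s k) ` cell a d"
      by blast
    then have "y \<in> cell a d"
      by (auto simp: im algebra_simps)
    have "wrap a d (x + lattice_point d k - lattice_point d k) = x"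
      using x A by (simp add: wrap_cell subset_iff)
    then have "wrap a d (x + lattice_point d k) = x"
      by (simp only: wrap_minus_lattice_point)
    then have "wrap a d (y + \<delta>) \<in> A"
      using x by (simp add: y algebra_simps)
    with \<open>y \<in> cell a d\<close> show "y \<in> ?B"
      by simp
  qed
  have sD: "(+) (?s k) ` ?D k \<in> sets lebesgue" for k
    by (intro lebesgue_sets_translation D)
  then show "?B \<in> sets lebesgue"
    unfolding B_eq by (intro sets.countable_UN) auto
  \<comment> \<open>A common point \<open>z\<close> of two translated pieces would give
    \<open>z + \<delta>\<close> two representatives in the cell. For the untranslated pieces below,
    the same argument applies to \<open>x - \<delta>\<close>, with the signs of the lattice vectors
    reversed.\<close>
  have disj_B: "disjoint_family (\<lambda>k. (+) (?s k) ` ?D k)"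
    unfolding disjoint_family_on_def
  proof (intro ballI impI equals0I)
    fix k l z assume kl: "k \<noteq> l" and "z \<in> (+) (?s k) ` ?D k \<inter> (+) (?s l) ` ?D l"
    then obtain x y where xy: "x \<in> A" "y \<in> A" "?s k + x = ?s l + y"
      by blast
    then have "x + lattice_point d k - lattice_point d l = y"
      by (simp add: algebra_simps)
    then have "(x + lattice_point d k) - lattice_point d l \<in> cell a d"
      using xy A by auto
    moreover have "(x + lattice_point d k) - lattice_point d k \<in> cell a d"
      using xy A by auto
    ultimately show False using kl
      using minus_lattice_point_in_cell_unique by blast
  qed
  have disj_D: "disjoint_family ?D"
    unfolding disjoint_family_on_def
  proof (intro ballI impI equals0I)
    fix k l x assume kl: "k \<noteq> l" and x: "x \<in> ?D k \<inter> ?D l"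
    have *: "lattice_point d (- j) = - lattice_point d j" for j
      by (simp add: lattice_point_def vec_eq_iff)
    have "x - \<delta> - lattice_point d (- j) \<in> cell a d" if "j \<in> {k, l}" for j
      using x that by (auto simp: im * algebra_simps)
    with kl show False
      using minus_lattice_point_in_cell_unique[of "x - \<delta>" "- k" "- l"] by simp
  qed
  have A_sub: "A \<subseteq> (\<Union>k. ?D k)"
  proof
    fix x assume x: "x \<in> A"
    obtain k where "wrap a d (x - \<delta>) = x - \<delta> - lattice_point d k"
      using wrap_eq_minus_lattice_point by blast
    then have "x - \<delta> - lattice_point d k \<in> cell a d"
      by (metis wrap_in_cell)
    moreover have "lattice_point d (- k) = - lattice_point d k"
      by (simp add: lattice_point_def vec_eq_iff)
    ultimately show "x \<in> (\<Union>k. ?D k)"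
      using x by (intro UN_I[of "-k"]) (simp_all add: im diff_diff_eq)
  qed
  have tr: "emeasure lebesgue ((+) c ` S) = emeasure lebesgue S" for c :: "real^'n" and S
    using emeasure_lebesgue_affine[of 1 c S] by (simp add: add.commute del: emeasure_completion cong: image_cong_simp)
  \<comment> \<open>The lattice is countable, so the measures of the disjoint pieces add up, and
    each piece keeps its measure under translation.\<close>
  have "emeasure lebesgue ?B = (\<integral>\<^sup>+k. emeasure lebesgue ((+) (?s k) ` ?D k) \<partial>count_space UNIV)"
    unfolding B_eq by (rule emeasure_UN_countable[OF _ _ disj_B]) (use sD in auto)
  also have "\<dots> = (\<integral>\<^sup>+k. emeasure lebesgue (?D k) \<partial>count_space UNIV)"
    by (simp only: tr)
  also have "\<dots> = emeasure lebesgue (\<Union>k. ?D k)"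
    by (rule emeasure_UN_countable[symmetric, OF _ _ disj_D]) (use D in auto)
  also have "(\<Union>k. ?D k) = A"
    using A_sub by blast
  finally show "emeasure lebesgue ?B = emeasure lebesgue A" .
qed

lemma measurable_wrap_translation:
  "(\<lambda>x. wrap a d (x + \<delta>)) \<in> lebesgue_on (cell a d) \<rightarrow>\<^sub>M lebesgue_on (cell a d)"
proof (rule measurableI)
  fix A assume "A \<in> sets (lebesgue_on (cell a d))"
  then have A: "A \<in> sets lebesgue" "A \<subseteq> cell a d"
    by (auto simp: sets_restrict_space_iff)
  have "(\<lambda>x. wrap a d (x + \<delta>)) -` A \<inter> space (lebesgue_on (cell a d)) = {x \<in> cell a d. wrap a d (x + \<delta>) \<in> A}"
    by (auto simp: space_restrict_space)
  then show "(\<lambda>x. wrap a d (x + \<delta>)) -` A \<inter> space (lebesgue_on (cell a d)) \<in> sets (lebesgue_on (cell a d))"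
    using wrap_translation_vimage(1)[OF A] by (simp add: sets_restrict_space_iff)
qed (auto simp: space_restrict_space wrap_in_cell)

lemma distr_wrap_translation:
  "distr (lebesgue_on (cell a d)) (lebesgue_on (cell a d)) (\<lambda>x. wrap a d (x + \<delta>)) = lebesgue_on (cell a d)"
proof (rule measure_eqI)
  fix A assume "A \<in> sets (distr (lebesgue_on (cell a d)) (lebesgue_on (cell a d)) (\<lambda>x. wrap a d (x + \<delta>)))"
  then have A': "A \<in> sets (lebesgue_on (cell a d))" and A: "A \<in> sets lebesgue" "A \<subseteq> cell a d"
    by (auto simp: sets_restrict_space_iff)
  have "(\<lambda>x. wrap a d (x + \<delta>)) -` A \<inter> space (lebesgue_on (cell a d)) = {x \<in> cell a d. wrap a d (x + \<delta>) \<in> A}"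
    by (auto simp: space_restrict_space)
  then show "emeasure (distr (lebesgue_on (cell a d)) (lebesgue_on (cell a d)) (\<lambda>x. wrap a d (x + \<delta>))) A
      = emeasure (lebesgue_on (cell a d)) A"
    using wrap_translation_vimage[OF A, of \<delta>] A
    by (simp add: emeasure_distr[OF measurable_wrap_translation A'] emeasure_restrict_space
        del: emeasure_completion)
qed simp

lemma nn_integral_wrap_translation:
  assumes f: "f \<in> borel_measurable (lebesgue_on (cell a d))"
  shows "(\<integral>\<^sup>+x. f (wrap a d (x + \<delta>)) \<partial>lebesgue_on (cell a d)) = (\<integral>\<^sup>+x. f x \<partial>lebesgue_on (cell a d))"
  using nn_integral_distr[OF measurable_wrap_translation, of f \<delta>] f
  by (simp add: distr_wrap_translation)

end

section \<open>Shifts in the Orlicz space\<close>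

lemma ennreal_tendsto_0_iff:
  fixes f :: "'a \<Rightarrow> ennreal"
  shows "(f \<longlongrightarrow> 0) F \<longleftrightarrow> (\<forall>e::real>0. \<forall>\<^sub>F x in F. f x < ennreal e)"
proof safe
  fix e :: real assume "(f \<longlongrightarrow> 0) F" "e > 0"
  then show "\<forall>\<^sub>F x in F. f x < ennreal e"
    by (intro order_tendstoD) auto
next
  assume *: "\<forall>e::real>0. \<forall>\<^sub>F x in F. f x < ennreal e"
  show "(f \<longlongrightarrow> 0) F"
  proof (rule order_tendstoI)
    fix c :: ennreal assume "0 < c"
    \<comment> \<open>An intermediate \<open>e\<close> is taken because \<open>c\<close> may be
      infinite, while the hypothesis concerns finite bounds.\<close>
    then obtain e :: ennreal where e: "0 < e" "e < c"
      using dense by blast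
    then have "e < top"
      by (meson less_le_trans top_greatest)
    with e have "ennreal (enn2real e) = e" "enn2real e > 0"
      by (auto simp: enn2real_positive_iff)
    with * have "\<forall>\<^sub>F x in F. f x < e"
      using spec[OF *, of "enn2real e"] by simp
    then show "\<forall>\<^sub>F x in F. f x < c"
      by eventually_elim (use e in auto)
  qed auto
qed

text \<open>Strictness survives because the bound \<open>ennreal c\<close> is finite; an infinite
  one would absorb the other summand.\<close>

lemma ennreal_add_le_less: "x \<le> ennreal c \<Longrightarrow> y < ennreal e \<Longrightarrow> x + y < ennreal c + ennreal e"
  by (rule le_less_trans[OF add_right_mono]) (auto simp: ennreal_add_left_cancel_less)

lemma shift_diff: "shift \<Omega> a \<delta> (\<lambda>x. u x - w x) x = shift \<Omega> a \<delta> u x - shift \<Omega> a \<delta> w x"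
  by (simp add: shift_def periodic_extension_def Let_def)

lemma nn_integral_lebesgue_on_superset:
  assumes "S \<in> sets lebesgue" "T \<in> sets lebesgue" "S \<subseteq> T" "\<And>x. x \<in> T - S \<Longrightarrow> f x = 0"
    and "\<And>x. x \<in> S \<Longrightarrow> f x = g x"
  shows "(\<integral>\<^sup>+x. f x \<partial>lebesgue_on T) = (\<integral>\<^sup>+x. g x \<partial>lebesgue_on S)"
proof -
  have "f x * indicator T x = g x * indicator S x" for x
    using assms(3-) by (auto simp: indicator_def)
  then show ?thesis
    using assms(1,2) by (simp add: nn_integral_restrict_space)
qed

section \<open>Translations of the cell acting on the Orlicz space\<close>

locale orlicz_cell =
  fixes M :: "real \<Rightarrow> real" and \<Omega> :: "(real^'n) set" and a :: "real^'n"
  assumes M: "N_function M"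
    and open_domain: "open \<Omega>" and bounded_domain: "bounded \<Omega>"
    and diameter_pos: "diameter \<Omega> > 0"
    and domain_subset_cell: "\<Omega> \<subseteq> cell a (diameter \<Omega>)"
begin

abbreviation "Q \<equiv> cell a (diameter \<Omega>)"
abbreviation "\<tau> \<delta> x \<equiv> wrap a (diameter \<Omega>) (x + \<delta>)"
abbreviation "N \<equiv> complementary M"
abbreviation "L \<equiv> orlicz_space M \<Omega>"
abbreviation "lnorm \<equiv> abs_orlicz_norm M \<Omega>"

lemma domain_lmeasurable: "\<Omega> \<in> lmeasurable"
  using bounded_domain open_domain by (intro bounded_set_imp_lmeasurable) auto

lemma domain_sets: "\<Omega> \<in> sets lebesgue"
  using domain_lmeasurable by (rule fmeasurableD)

lemma cell_sets: "Q \<in> sets lebesgue"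
  by simp

definition zero_ext :: "(real^'n \<Rightarrow> complex) \<Rightarrow> real^'n \<Rightarrow> complex" where
  "zero_ext f x = (if x \<in> \<Omega> then f x else 0)"

lemma shift_eq: "shift \<Omega> a \<delta> f x = zero_ext f (\<tau> \<delta> x)"
  by (simp add: shift_def periodic_extension_def zero_ext_def wrap_def Let_def)

lemma zero_ext_measurable:
  "f \<in> borel_measurable (lebesgue_on \<Omega>) \<Longrightarrow> zero_ext f \<in> borel_measurable (lebesgue_on Q)"
  unfolding zero_ext_def[abs_def]
  using borel_measurable_if_lebesgue_on[OF domain_sets cell_sets domain_subset_cell] by blast

lemma shift_measurable_cell:
  "f \<in> borel_measurable (lebesgue_on \<Omega>) \<Longrightarrow> shift \<Omega> a \<delta> f \<in> borel_measurable (lebesgue_on Q)"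
  unfolding shift_eq[abs_def]
  by (rule measurable_compose[OF measurable_wrap_translation[OF diameter_pos] zero_ext_measurable])

lemma shift_measurable:
  "f \<in> borel_measurable (lebesgue_on \<Omega>) \<Longrightarrow> shift \<Omega> a \<delta> f \<in> borel_measurable (lebesgue_on \<Omega>)"
  using measurable_restrict_mono[OF shift_measurable_cell domain_subset_cell] .

text \<open>The adjoint of a shift is the opposite shift: a substitution by the measure-preserving
  translation of the cell. The zero extensions of \<open>u\<close> and \<open>v\<close> confine the
  integrals over the cell to \<open>\<Omega>\<close>.\<close>

lemma nn_integral_shift_mult:
  assumes u: "u \<in> borel_measurable (lebesgue_on \<Omega>)" and v: "v \<in> borel_measurable (lebesgue_on \<Omega>)"
  shows "(\<integral>\<^sup>+x. ennreal (cmod (shift \<Omega> a \<delta> u x) * cmod (v x)) \<partial>lebesgue_on \<Omega>)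
    = (\<integral>\<^sup>+x. ennreal (cmod (u x) * cmod (shift \<Omega> a (- \<delta>) v x)) \<partial>lebesgue_on \<Omega>)"
proof -
  define g where "g y = ennreal (cmod (zero_ext u y) * cmod (shift \<Omega> a (- \<delta>) v y))" for y
  have [measurable]: "g \<in> borel_measurable (lebesgue_on Q)"
    unfolding g_def using zero_ext_measurable[OF u] shift_measurable_cell[OF v] by measurable
  have "\<tau> (- \<delta>) (\<tau> \<delta> x) = x" if "x \<in> Q" for x
    using that wrap_wrap_add[OF diameter_pos, of a "x + \<delta>" "- \<delta>"] by (simp add: wrap_cell[OF diameter_pos])
  then have g: "g (\<tau> \<delta> x) = ennreal (cmod (shift \<Omega> a \<delta> u x) * cmod (zero_ext v x))" if "x \<in> Q" for x
    using that by (simp add: g_def shift_eq)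
  have "(\<integral>\<^sup>+x. ennreal (cmod (shift \<Omega> a \<delta> u x) * cmod (v x)) \<partial>lebesgue_on \<Omega>)
     = (\<integral>\<^sup>+x. g (\<tau> \<delta> x) \<partial>lebesgue_on Q)"
    using domain_subset_cell
    by (intro nn_integral_lebesgue_on_superset[symmetric] domain_sets cell_sets)
       (auto simp: g zero_ext_def subset_iff)
  also have "\<dots> = (\<integral>\<^sup>+x. g x \<partial>lebesgue_on Q)"
    by (rule nn_integral_wrap_translation[OF diameter_pos]) measurable
  also have "\<dots> = (\<integral>\<^sup>+x. ennreal (cmod (u x) * cmod (shift \<Omega> a (- \<delta>) v x)) \<partial>lebesgue_on \<Omega>)"
    using domain_subset_cell
    by (intro nn_integral_lebesgue_on_superset domain_sets cell_sets)
       (auto simp: g_def zero_ext_def)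
  finally show ?thesis .
qed

text \<open>Over the whole cell the modular is invariant, and zero extension adds nothing since
  \<open>N 0 = 0\<close>. Only an inequality remains because the shifted function may carry mass in
  the cell outside \<open>\<Omega>\<close>.\<close>

lemma modular_shift_le:
  assumes v: "v \<in> borel_measurable (lebesgue_on \<Omega>)"
  shows "modular N \<Omega> (shift \<Omega> a \<delta> v) \<le> modular N \<Omega> v"
proof -
  note [measurable] = borel_measurable_complementary[OF M] zero_ext_measurable[OF v]
  have "modular N \<Omega> (shift \<Omega> a \<delta> v)
      \<le> (\<integral>\<^sup>+x. ennreal (N (cmod (shift \<Omega> a \<delta> v x))) \<partial>lebesgue_on Q)"
    unfolding modular_def using domain_subset_cell domain_sets cell_sets
    by (auto simp: nn_integral_restrict_space indicator_def intro!: nn_integral_mono)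
  also have "\<dots> = (\<integral>\<^sup>+x. ennreal (N (cmod (zero_ext v x))) \<partial>lebesgue_on Q)"
    unfolding shift_eq
    by (rule nn_integral_wrap_translation[OF diameter_pos, where f = "\<lambda>x. ennreal (N (cmod (zero_ext v x)))"])
       measurable
  also have "\<dots> = modular N \<Omega> v"
    unfolding modular_def using domain_subset_cell
    by (intro nn_integral_lebesgue_on_superset domain_sets cell_sets)
       (auto simp: zero_ext_def complementary_zero[OF M])
  finally show ?thesis .
qed

lemma shift_in_orlicz_space:
  assumes "u \<in> L"
  shows "shift \<Omega> a \<delta> u \<in> L"
  using assms unfolding orlicz_space_iff
  by (auto simp: nn_integral_shift_mult shift_measurable intro: le_less_trans[OF modular_shift_le])

lemma lnorm_shift_le:
  assumes u: "u \<in> borel_measurable (lebesgue_on \<Omega>)"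
  shows "lnorm (shift \<Omega> a \<delta> u) \<le> lnorm u"
proof (rule abs_orlicz_norm_least)
  fix v assume v: "v \<in> borel_measurable (lebesgue_on \<Omega>)" "modular N \<Omega> v \<le> 1"
  show "(\<integral>\<^sup>+x. ennreal (cmod (shift \<Omega> a \<delta> u x) * cmod (v x)) \<partial>lebesgue_on \<Omega>) \<le> lnorm u"
    unfolding nn_integral_shift_mult[OF u v(1)]
    using v by (intro abs_orlicz_norm_upper shift_measurable order_trans[OF modular_shift_le])
qed

text \<open>The error \<open>u - w\<close> enters twice, shifted and unshifted, and shifting does
  not increase its norm; hence the factor 2.\<close>

lemma lnorm_shift_diff_le:
  assumes [measurable]: "u \<in> borel_measurable (lebesgue_on \<Omega>)" "w \<in> borel_measurable (lebesgue_on \<Omega>)"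
  shows "lnorm (\<lambda>x. shift \<Omega> a \<delta> u x - u x)
    \<le> 2 * lnorm (\<lambda>x. u x - w x) + lnorm (\<lambda>x. shift \<Omega> a \<delta> w x - w x)"
proof -
  note [measurable] = shift_measurable
  let ?h = "\<lambda>x. u x - w x" and ?g = "\<lambda>x. shift \<Omega> a \<delta> w x - w x"
  have "lnorm (\<lambda>x. shift \<Omega> a \<delta> u x - u x) \<le> lnorm (\<lambda>x. shift \<Omega> a \<delta> ?h x - ?h x) + lnorm ?g"
  proof (rule abs_orlicz_norm_add)
    show "cmod (shift \<Omega> a \<delta> u x - u x) \<le> cmod (shift \<Omega> a \<delta> ?h x - ?h x) + cmod (?g x)" for x
      using norm_triangle_ineq[of "shift \<Omega> a \<delta> ?h x - ?h x" "?g x"]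
      by (simp add: shift_diff)
  qed measurable
  also have "lnorm (\<lambda>x. shift \<Omega> a \<delta> ?h x - ?h x) \<le> lnorm (shift \<Omega> a \<delta> ?h) + lnorm ?h"
    by (rule abs_orlicz_norm_add) (auto intro: norm_triangle_ineq4)
  also have "lnorm (shift \<Omega> a \<delta> ?h) \<le> lnorm ?h"
    by (rule lnorm_shift_le) measurable
  finally show ?thesis
    by (simp add: mult_2 add_mono)
qed

text \<open>It has two uses: norm limits of test functions, and passage to an a.e. equal function,
  which lies at distance 0. The approximation within \<open>e/4\<close> is counted twice, leaving
  \<open>e/2\<close> for the shifts of \<open>w\<close>.\<close>

lemma lnorm_shift_tendsto_closed:
  assumes u: "u \<in> borel_measurable (lebesgue_on \<Omega>)"
    and appr: "\<And>\<epsilon>::real. \<epsilon> > 0 \<Longrightarrow> \<exists>w\<in>borel_measurable (lebesgue_on \<Omega>). lnorm (\<lambda>x. u x - w x) < ennreal \<epsilon> \<and>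
        ((\<lambda>\<delta>. lnorm (\<lambda>x. shift \<Omega> a \<delta> w x - w x)) \<longlongrightarrow> 0) (at 0)"
  shows "((\<lambda>\<delta>. lnorm (\<lambda>x. shift \<Omega> a \<delta> u x - u x)) \<longlongrightarrow> 0) (at 0)"
  unfolding ennreal_tendsto_0_iff
proof safe
  fix e :: real assume e: "e > 0"
  then obtain w where w: "w \<in> borel_measurable (lebesgue_on \<Omega>)" "lnorm (\<lambda>x. u x - w x) < ennreal (e/4)"
    and lim: "((\<lambda>\<delta>. lnorm (\<lambda>x. shift \<Omega> a \<delta> w x - w x)) \<longlongrightarrow> 0) (at 0)"
    using appr[of "e/4"] by auto
  have "\<forall>\<^sub>F \<delta> in at 0. lnorm (\<lambda>x. shift \<Omega> a \<delta> w x - w x) < ennreal (e/2)"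
    using lim e by (simp add: ennreal_tendsto_0_iff)
  then show "\<forall>\<^sub>F \<delta> in at 0. lnorm (\<lambda>x. shift \<Omega> a \<delta> u x - u x) < ennreal e"
  proof eventually_elim
    case (elim \<delta>)
    have "lnorm (\<lambda>x. shift \<Omega> a \<delta> u x - u x)
        \<le> 2 * lnorm (\<lambda>x. u x - w x) + lnorm (\<lambda>x. shift \<Omega> a \<delta> w x - w x)"
      by (rule lnorm_shift_diff_le[OF u w(1)])
    also have "\<dots> < ennreal (e/2) + ennreal (e/2)"
    proof (rule ennreal_add_le_less)
      have "2 * lnorm (\<lambda>x. u x - w x) \<le> 2 * ennreal (e/4)"
        using w(2) by (intro mult_left_mono) auto
      also have "\<dots> = ennreal 2 * ennreal (e/4)"
        by simp
      also have "\<dots> = ennreal (e/2)"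
        using e by (subst ennreal_mult[symmetric]) auto
      finally show "2 * lnorm (\<lambda>x. u x - w x) \<le> ennreal (e/2)" .
    qed (use elim in auto)
    also have "\<dots> = ennreal e"
      using e by (simp flip: ennreal_plus)
    finally show ?case .
  qed
qed

text \<open>
  If a small shift moves a point of the cell out of it, then neither the point nor its wrapped
  image lies in the compact support.
\<close>

lemma lnorm_shift_tendsto_continuous:
  assumes cont: "continuous_on UNIV \<phi>"
    and comp: "compact (closure {x. \<phi> x \<noteq> 0})" and supp: "closure {x. \<phi> x \<noteq> 0} \<subseteq> \<Omega>"
  shows "((\<lambda>\<delta>. lnorm (\<lambda>x. shift \<Omega> a \<delta> \<phi> x - \<phi> x)) \<longlongrightarrow> 0) (at 0)"
  unfolding ennreal_tendsto_0_iff
proof safe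
  fix e :: real assume e: "e > 0"
  define K where "K = enn2real (lnorm (\<lambda>x. 1))"
  \<comment> \<open>The \<open>+ 1\<close> covers \<open>K = 0\<close> and makes
    \<open>\<epsilon> * K < e\<close> strict.\<close>
  define \<epsilon> where "\<epsilon> = e / (K + 1)"
  have K: "K \<ge> 0"
    by (simp add: K_def)
  with e have \<epsilon>: "\<epsilon> > 0" "\<epsilon> * K < e"
    by (auto simp: \<epsilon>_def field_simps)
  have zero: "zero_ext \<phi> = \<phi>"
    using supp closure_subset[of "{x. \<phi> x \<noteq> 0}"] by (auto simp: zero_ext_def fun_eq_iff subset_iff)
  obtain r where r: "r > 0" "(\<Union>x\<in>closure {x. \<phi> x \<noteq> 0}. ball x r) \<subseteq> \<Omega>"
    using compact_subset_open_imp_ball_epsilon_subset[OF comp open_domain supp] by blast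
  have near: "y \<in> \<Omega>" if "\<phi> x \<noteq> 0" "dist x y < r" for x y
  proof -
    have "x \<in> closure {x. \<phi> x \<noteq> 0}"
      using that closure_subset[of "{x. \<phi> x \<noteq> 0}"] by auto
    with that have "y \<in> (\<Union>x\<in>closure {x. \<phi> x \<noteq> 0}. ball x r)"
      by (intro UN_I[of x]) auto
    with r show ?thesis
      by blast
  qed
  have "uniformly_continuous_on (cbox a (a + vec (diameter \<Omega>))) \<phi>"
    using cont by (intro compact_uniformly_continuous) (auto intro: continuous_on_subset)
  then obtain s where s: "s > 0"
    "\<And>x y. x \<in> cbox a (a + vec (diameter \<Omega>)) \<Longrightarrow> y \<in> cbox a (a + vec (diameter \<Omega>)) \<Longrightarrow> dist y x < s \<Longrightarrow> dist (\<phi> y) (\<phi> x) < \<epsilon>"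
    using \<epsilon>(1) unfolding uniformly_continuous_on_def by meson
  have bound: "cmod (shift \<Omega> a \<delta> \<phi> x - \<phi> x) \<le> \<epsilon>" if \<delta>: "norm \<delta> < min r s" and x: "x \<in> \<Omega>" for \<delta> x
  proof (cases "x + \<delta> \<in> Q")
    case True
    then have "\<tau> \<delta> x = x + \<delta>"
      by (simp add: wrap_cell[OF diameter_pos])
    moreover have "dist (\<phi> (x + \<delta>)) (\<phi> x) < \<epsilon>"
      by (rule s) (use True x \<delta> domain_subset_cell cell_subset_cbox in \<open>auto simp: dist_norm\<close>)
    ultimately show ?thesis
      by (simp add: shift_eq zero dist_norm)
  next
    case False
    have x0: "\<phi> x = 0"
    proof (rule ccontr)
      assume "\<phi> x \<noteq> 0"
      then have "x + \<delta> \<in> \<Omega>"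
        by (rule near) (use \<delta> in \<open>simp add: dist_norm\<close>)
      with False domain_subset_cell show False
        by blast
    qed
    have "\<phi> (\<tau> \<delta> x) = 0"
    proof (rule ccontr)
      assume "\<phi> (\<tau> \<delta> x) \<noteq> 0"
      then have "\<tau> \<delta> x - \<delta> \<in> \<Omega>"
        by (rule near) (use \<delta> in \<open>simp add: dist_norm\<close>)
      \<comment> \<open>Moving back by \<open>\<delta>\<close> from a point of the support stays in
        the domain, so nothing is wrapped and the point reached is \<open>x\<close> itself. Then
        \<open>x + \<delta>\<close> would lie in the cell.\<close>
      then have "\<tau> \<delta> x - \<delta> = wrap a (diameter \<Omega>) (\<tau> \<delta> x + (- \<delta>))"
        using domain_subset_cell wrap_cell[OF diameter_pos, of "\<tau> \<delta> x - \<delta>" a] by auto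
      also have "\<dots> = x"
        unfolding wrap_wrap_add[OF diameter_pos] using x domain_subset_cell
        by (simp add: wrap_cell[OF diameter_pos] subset_iff)
      finally have "\<tau> \<delta> x = x + \<delta>"
        by (simp add: algebra_simps)
      with False wrap_in_cell[OF diameter_pos, of a "x + \<delta>"] show False
        by simp
    qed
    with x0 \<epsilon> show ?thesis
      by (simp add: shift_eq zero)
  qed
  have "\<forall>\<^sub>F \<delta> in at 0. norm (\<delta>::real^'n) < min r s"
    using r s by (auto simp: eventually_at dist_norm intro!: exI[of _ "min r s"])
  then show "\<forall>\<^sub>F \<delta> in at 0. lnorm (\<lambda>x. shift \<Omega> a \<delta> \<phi> x - \<phi> x) < ennreal e"
  proof eventually_elim
    case (elim \<delta>)
    have "lnorm (\<lambda>x. shift \<Omega> a \<delta> \<phi> x - \<phi> x) \<le> ennreal (\<epsilon> * K)"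
      unfolding K_def using bound elim \<epsilon> by (intro abs_orlicz_norm_le_sup M domain_lmeasurable) auto
    also have "\<dots> < ennreal e"
      using \<epsilon> e by (intro ennreal_lessI) auto
    finally show ?case .
  qed
qed

end

section \<open>Smooth bump functions\<close>

text \<open>The classical \<open>exp (- 1 / t)\<close>, divided by powers of \<open>t\<close> so
  that derivatives are linear combinations of members of the family.\<close>

definition flat :: "nat \<Rightarrow> real \<Rightarrow> real" where
  "flat k t = (if t > 0 then exp (- 1 / t) / t ^ k else 0)"

lemma flat_has_real_derivative:
  "(flat k has_real_derivative (flat (k + 2) t - of_nat k * flat (k + 1) t)) (at t)"
proof -
  consider "t > 0" | "t < 0" | "t = 0"
    by linarith
  then show ?thesis
  proof cases
    case 1
    have "((\<lambda>t. exp (- 1 / t) / t ^ k) has_real_derivative (flat (k + 2) t - of_nat k * flat (k + 1) t)) (at t)"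
      using 1
      by (auto intro!: derivative_eq_intros simp: flat_def divide_simps power2_eq_square)
         (cases k; simp add: algebra_simps power_add)
    then show ?thesis
      by (rule has_field_derivative_transform_within_open[of _ _ _ "{0<..}"])
         (use 1 in \<open>auto simp: flat_def\<close>)
  next
    case 2
    have "((\<lambda>t. 0) has_real_derivative 0) (at t)"
      by simp
    then have "(flat k has_real_derivative 0) (at t)"
      by (rule has_field_derivative_transform_within_open[of _ _ _ "{..<0}"])
         (use 2 in \<open>auto simp: flat_def\<close>)
    with 2 show ?thesis
      by (simp add: flat_def)
  next
    case 3
    \<comment> \<open>This is the difference quotient \<open>flat k h / h\<close> at 0 from the
      right, written in the variable \<open>inverse h\<close>.\<close>
    have "((\<lambda>h. inverse h ^ (k + 1) / exp (inverse h)) \<longlongrightarrow> 0) (at_right (0::real))"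
      by (rule filterlim_compose[OF tendsto_power_div_exp_0 filterlim_inverse_at_top_right])
    then have "((\<lambda>h. flat k h / h) \<longlongrightarrow> 0) (at_right 0)"
      by (rule tendsto_cong[THEN iffD1, rotated])
         (auto simp: eventually_at_filter flat_def exp_minus divide_simps)
    moreover have "((\<lambda>h. flat k h / h) \<longlongrightarrow> 0) (at_left 0)"
      by (rule tendsto_eventually) (auto simp: eventually_at_filter flat_def)
    ultimately have "((\<lambda>h. flat k h / h) \<longlongrightarrow> 0) (at 0)"
      by (simp add: filterlim_at_split)
    with 3 show ?thesis
      by (simp add: DERIV_def flat_def)
  qed
qed

lemma flat_0_range: "0 \<le> flat 0 t" "flat 0 t \<le> 1" "flat 0 t > 0 \<longleftrightarrow> t > 0"
  by (auto simp: flat_def)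

text \<open>An algebra closed under directional derivatives: no estimate of higher derivatives is needed.\<close>

inductive_set smooth_algebra :: "('a::euclidean_space \<Rightarrow> complex) set" where
  const: "(\<lambda>x. c) \<in> smooth_algebra"
| inner: "(\<lambda>x. complex_of_real (x \<bullet> h)) \<in> smooth_algebra"
| add: "f \<in> smooth_algebra \<Longrightarrow> g \<in> smooth_algebra \<Longrightarrow> (\<lambda>x. f x + g x) \<in> smooth_algebra"
| mult: "f \<in> smooth_algebra \<Longrightarrow> g \<in> smooth_algebra \<Longrightarrow> (\<lambda>x. f x * g x) \<in> smooth_algebra"
| flat: "(\<lambda>x. complex_of_real (flat k (r - (x - z) \<bullet> (x - z)))) \<in> smooth_algebra"

lemma smooth_algebra_diff:
  assumes "f \<in> smooth_algebra" "g \<in> smooth_algebra"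
  shows "(\<lambda>x. f x - g x) \<in> smooth_algebra"
  using add[OF assms(1) mult[OF const[of "-1"] assms(2)]] by simp

lemma smooth_algebra_prod:
  "(\<And>i. i \<in> I \<Longrightarrow> f i \<in> smooth_algebra) \<Longrightarrow> (\<lambda>x. \<Prod>i\<in>I. f i x) \<in> smooth_algebra"
  by (induction I rule: infinite_finite_induct) (auto intro: const mult)

lemma smooth_algebra_power: "f \<in> smooth_algebra \<Longrightarrow> (\<lambda>x. f x ^ m) \<in> smooth_algebra"
  by (induction m) (auto intro: const mult)

text \<open>The derivative is returned to the algebra for each fixed direction \<open>h\<close>,
  which is what an induction on the order of differentiation consumes.\<close>

lemma smooth_algebra_has_derivative:
  assumes "f \<in> smooth_algebra"
  shows "\<exists>f'. (\<forall>x. (f has_derivative f' x) (at x)) \<and> (\<forall>h. (\<lambda>x. f' x h) \<in> smooth_algebra)"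
  using assms
proof induction
  case (const c)
  show ?case
    by (intro exI[of _ "\<lambda>x h. 0"]) (auto intro: smooth_algebra.const)
next
  case (inner h)
  show ?case
    by (intro exI[of _ "\<lambda>x v. complex_of_real (v \<bullet> h)"])
       (auto intro!: smooth_algebra.const derivative_eq_intros)
next
  case (add f g)
  then obtain f' g' where "\<And>x. (f has_derivative f' x) (at x)" "\<And>h. (\<lambda>x. f' x h) \<in> smooth_algebra"
    "\<And>x. (g has_derivative g' x) (at x)" "\<And>h. (\<lambda>x. g' x h) \<in> smooth_algebra"
    by blast
  then show ?case
    by (intro exI[of _ "\<lambda>x h. f' x h + g' x h"]) (auto intro!: smooth_algebra.add has_derivative_add)
next
  case (mult f g)
  then obtain f' g' where "\<And>x. (f has_derivative f' x) (at x)" "\<And>h. (\<lambda>x. f' x h) \<in> smooth_algebra"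
    "\<And>x. (g has_derivative g' x) (at x)" "\<And>h. (\<lambda>x. g' x h) \<in> smooth_algebra"
    by blast
  with mult.hyps show ?case
    by (intro exI[of _ "\<lambda>x h. f x * g' x h + f' x h * g x"])
       (auto intro!: smooth_algebra.add smooth_algebra.mult has_derivative_mult)
next
  case (flat k r z)
  define s where "s x = r - (x - z) \<bullet> (x - z)" for x :: 'a
  define f' where "f' x v = complex_of_real ((- 2 * ((x - z) \<bullet> v)) * (flat (k + 2) (s x) - of_nat k * flat (k + 1) (s x)))"
    for x v :: 'a
  have "((\<lambda>x. complex_of_real (flat k (s x))) has_derivative f' x) (at x)" for x
  proof -
    have s: "(s has_derivative (\<lambda>v. - 2 * ((x - z) \<bullet> v))) (at x)"
      unfolding s_def[abs_def]
      by (auto intro!: derivative_eq_intros simp: inner_commute algebra_simps)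
    have "((\<lambda>x. flat k (s x)) has_derivative
        (\<lambda>v. (- 2 * ((x - z) \<bullet> v)) * (flat (k + 2) (s x) - of_nat k * flat (k + 1) (s x)))) (at x)"
      using has_derivative_compose[OF s flat_has_real_derivative[of k "s x", unfolded has_field_derivative_def]]
      by (simp add: mult.commute)
    then show ?thesis
      unfolding f'_def[abs_def] by (rule has_derivative_of_real)
  qed
  moreover have "(\<lambda>x. f' x v) \<in> smooth_algebra" for v
  proof -
    have "(\<lambda>x. f' x v) = (\<lambda>x. (complex_of_real (- 2) * (complex_of_real (x \<bullet> v) - complex_of_real (z \<bullet> v))) *
       (complex_of_real (flat (k + 2) (r - (x - z) \<bullet> (x - z)))
         - of_nat k * complex_of_real (flat (k + 1) (r - (x - z) \<bullet> (x - z)))))"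
      by (simp add: f'_def s_def inner_diff_left)
    also have "\<dots> \<in> smooth_algebra"
      by (intro smooth_algebra.mult smooth_algebra_diff smooth_algebra.const smooth_algebra.inner
          smooth_algebra.flat)
    finally show ?thesis .
  qed
  ultimately show ?case
    unfolding s_def by blast
qed

lemma smooth_algebra_times_differentiable: "f \<in> smooth_algebra \<Longrightarrow> times_differentiable k f"
proof (induction k arbitrary: f)
  case 0
  then obtain f' where "\<And>x. (f has_derivative f' x) (at x)"
    using smooth_algebra_has_derivative by blast
  then show ?case
    by (auto simp: continuous_on_eq_continuous_at intro: has_derivative_continuous)
next
  case (Suc k)
  then obtain f' where f': "\<And>x. (f has_derivative f' x) (at x)" "\<And>h. (\<lambda>x. f' x h) \<in> smooth_algebra"
    using smooth_algebra_has_derivative by blast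
  then have "frechet_derivative f (at x) = f' x" for x
    using frechet_derivative_at[symmetric] by blast
  with f' Suc.IH show ?case
    by (auto simp: differentiable_def)
qed

lemma smooth_algebra_continuous_on: "f \<in> smooth_algebra \<Longrightarrow> continuous_on S f"
  using smooth_algebra_times_differentiable[of f 0] by (auto intro: continuous_on_subset)

lemma smooth_algebra_test_function:
  assumes "f \<in> smooth_algebra" "compact C" "C \<subseteq> \<Omega>" "\<And>x. x \<notin> C \<Longrightarrow> f x = 0"
  shows "f \<in> test_functions \<Omega>"
proof -
  have "closure {x. f x \<noteq> 0} \<subseteq> C"
    using assms by (intro closure_minimal compact_imp_closed) auto
  moreover from this have "compact (closure {x. f x \<noteq> 0})"
    using compact_Int_closed[OF assms(2), of "closure {x. f x \<noteq> 0}"] by (simp add: Int_absorb1)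
  ultimately show ?thesis
    using assms smooth_algebra_times_differentiable by (auto simp: test_functions_def)
qed

text \<open>The product of the factors \<open>1 - \<beta> z\<close> is 1 off the balls and, by
  compactness, at most some \<open>q < 1\<close> on \<open>K\<close>. A high power makes it small on
  \<open>K\<close> without leaving the algebra, which offers products but no division; hence a
  plateau only up to \<open>\<epsilon>\<close>.\<close>

lemma smooth_approximate_Urysohn:
  fixes K U :: "('a::euclidean_space) set"
  assumes K: "compact K" and U: "open U" and KU: "K \<subseteq> U" and \<epsilon>: "\<epsilon> > 0"
  obtains \<phi> :: "'a \<Rightarrow> real" and C where "(\<lambda>x. complex_of_real (\<phi> x)) \<in> smooth_algebra" "compact C" "C \<subseteq> U"
    "\<And>x. 0 \<le> \<phi> x" "\<And>x. \<phi> x \<le> 1" "\<And>x. x \<notin> C \<Longrightarrow> \<phi> x = 0" "\<And>x. x \<in> K \<Longrightarrow> 1 - \<phi> x \<le> \<epsilon>"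
proof -
  have "\<exists>r>0. cball x r \<subseteq> U" if "x \<in> K" for x
    using that U KU open_contains_cball by blast
  then obtain r where r: "\<And>x. x \<in> K \<Longrightarrow> r x > 0" "\<And>x. x \<in> K \<Longrightarrow> cball x (r x) \<subseteq> U"
    by metis
  have "K \<subseteq> (\<Union>x\<in>K. ball x (r x))"
    using r by force
  then obtain F where F: "F \<subseteq> K" "finite F" "K \<subseteq> (\<Union>x\<in>F. ball x (r x))"
    using compactE_image[OF K, of K "\<lambda>x. ball x (r x)"] by auto
  define \<beta> where "\<beta> z x = flat 0 ((r z)\<^sup>2 - (x - z) \<bullet> (x - z))" for z x
  define \<psi> where "\<psi> x = (\<Prod>z\<in>F. 1 - \<beta> z x)" for x
  have \<beta>01: "0 \<le> \<beta> z x" "\<beta> z x \<le> 1" for z x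
    by (auto simp: \<beta>_def flat_0_range)
  have \<beta>_pos: "\<beta> z x > 0 \<longleftrightarrow> x \<in> ball z (r z)" if "z \<in> F" for z x
  proof -
    have "\<beta> z x > 0 \<longleftrightarrow> (norm (x - z))\<^sup>2 < (r z)\<^sup>2"
      by (simp add: \<beta>_def flat_0_range(3) power2_norm_eq_inner)
    also have "\<dots> \<longleftrightarrow> norm (x - z) < r z"
      using r(1)[of z] F that power_mono_iff[of "r z" "norm (x - z)" 2] by (auto simp flip: not_le)
    finally show ?thesis
      by (simp add: dist_norm norm_minus_commute)
  qed
  have \<psi>01: "0 \<le> \<psi> x" "\<psi> x \<le> 1" for x
    using \<beta>01 by (auto simp: \<psi>_def intro!: prod_nonneg prod_le_1)
  have \<psi>_less: "\<psi> x < 1" if xK: "x \<in> K" for x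
  proof -
    obtain z where z: "z \<in> F" "x \<in> ball z (r z)"
      using F xK by blast
    have "\<psi> x = (1 - \<beta> z x) * (\<Prod>z\<in>F - {z}. 1 - \<beta> z x)"
      unfolding \<psi>_def using F z by (subst prod.remove[of _ z]) auto
    also have "\<dots> \<le> (1 - \<beta> z x) * 1"
      using \<beta>01 by (intro mult_left_mono prod_le_1) auto
    also have "\<dots> < 1"
      using \<beta>_pos[OF z(1)] z by simp
    finally show ?thesis .
  qed
  have smooth: "(\<lambda>x. complex_of_real (\<psi> x)) \<in> smooth_algebra"
    unfolding \<psi>_def \<beta>_def of_real_prod of_real_diff of_real_1
    by (intro smooth_algebra_prod smooth_algebra_diff const flat)
  then have "continuous_on K (\<lambda>x. Re (complex_of_real (\<psi> x)))"
    by (intro continuous_on_Re smooth_algebra_continuous_on)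
  then have cont: "continuous_on K \<psi>"
    by simp
  obtain q where q: "q < 1" "0 \<le> q" "\<And>x. x \<in> K \<Longrightarrow> \<psi> x \<le> q"
  proof (cases "K = {}")
    case False
    then obtain y where "y \<in> K" "\<And>x. x \<in> K \<Longrightarrow> \<psi> x \<le> \<psi> y"
      using continuous_attains_sup[OF K False cont] by blast
    with that show ?thesis
      using \<psi>_less \<psi>01 by blast
  qed (use that[of 0] in auto)
  obtain m where m: "q ^ m < \<epsilon>"
    using real_arch_pow_inv[OF \<epsilon> q(1)] by blast
  show ?thesis
  proof (rule that[of "\<lambda>x. 1 - \<psi> x ^ m" "\<Union>z\<in>F. cball z (r z)"])
    show "(\<lambda>x. complex_of_real (1 - \<psi> x ^ m)) \<in> smooth_algebra"
      unfolding of_real_diff of_real_1 of_real_power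
      by (intro smooth_algebra_diff const smooth_algebra_power smooth)
    show "compact (\<Union>z\<in>F. cball z (r z))"
      using F(2) by (intro compact_UN) simp_all
    show "(\<Union>z\<in>F. cball z (r z)) \<subseteq> U"
    proof (rule UN_least)
      show "cball z (r z) \<subseteq> U" if "z \<in> F" for z
        using r(2) F(1) that by (meson subsetD)
    qed
    show "0 \<le> 1 - \<psi> x ^ m" "1 - \<psi> x ^ m \<le> 1" for x
      using \<psi>01 by (auto intro: power_le_one)
    show "1 - \<psi> x ^ m = 0" if "x \<notin> (\<Union>z\<in>F. cball z (r z))" for x
    proof -
      have "\<beta> z x = 0" if "z \<in> F" for z
        using \<beta>_pos[OF that, of x] \<beta>01[of z x] \<open>x \<notin> _\<close> that by force
      then show ?thesis
        by (simp add: \<psi>_def)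
    qed
    show "1 - (1 - \<psi> x ^ m) \<le> \<epsilon>" if "x \<in> K" for x
      using power_mono[OF q(3)[OF that] \<psi>01(1), of m] m by simp
  qed
qed

section \<open>Approximation of bounded functions by test functions\<close>

lemma test_function_continuous: "\<phi> \<in> test_functions \<Omega> \<Longrightarrow> continuous_on UNIV \<phi>"
  using times_differentiable.simps(1) by (auto simp: test_functions_def simp del: times_differentiable.simps)

lemma test_function_supportE:
  assumes "\<phi> \<in> test_functions \<Omega>"
  obtains C where "compact C" "C \<subseteq> \<Omega>" "\<And>x. x \<notin> C \<Longrightarrow> \<phi> x = 0"
proof
  show "compact (closure {x. \<phi> x \<noteq> 0})" "closure {x. \<phi> x \<noteq> 0} \<subseteq> \<Omega>"
    using assms by (auto simp: test_functions_def)
  show "\<phi> x = 0" if "x \<notin> closure {x. \<phi> x \<noteq> 0}" for x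
    using that closure_subset[of "{x. \<phi> x \<noteq> 0}"] by blast
qed

lemma borel_measurable_imp_lebesgue_on:
  "f \<in> borel_measurable borel \<Longrightarrow> f \<in> borel_measurable (lebesgue_on S)"
  by (rule measurable_restrict_space1, rule measurable_completion) simp

locale orlicz_cell_ac = orlicz_cell M \<Omega> a for M and \<Omega> :: "(real^'n) set" and a +
  assumes indicator_small: "\<And>\<epsilon>::real. \<epsilon> > 0 \<Longrightarrow> \<exists>\<eta>>0. \<forall>E \<in> sets lebesgue. E \<subseteq> \<Omega> \<and> measure lebesgue E < \<eta> \<longrightarrow>
           orlicz_norm M \<Omega> (indicator E) < ennreal \<epsilon>"
begin

abbreviation "X \<equiv> borel_measurable (lebesgue_on \<Omega>) :: (real^'n \<Rightarrow> complex) set"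

text \<open>Approximants are also taken from \<open>smooth_algebra\<close>, where sums and multiples
  are smooth by construction, so iterated derivatives of general test functions need not be
  added.\<close>

definition smooth_approximable :: "(real^'n \<Rightarrow> complex) \<Rightarrow> bool" where
  "smooth_approximable f \<longleftrightarrow> f \<in> X \<and>
     (\<forall>\<epsilon>::real>0. \<exists>\<phi>\<in>smooth_algebra \<inter> test_functions \<Omega>. lnorm (\<lambda>x. f x - \<phi> x) < ennreal \<epsilon>)"

lemma test_function_measurable: "\<phi> \<in> test_functions \<Omega> \<Longrightarrow> \<phi> \<in> X"
  by (intro borel_measurable_imp_lebesgue_on borel_measurable_continuous_onI test_function_continuous)

lemma test_function_in_orlicz_space:
  assumes "\<phi> \<in> test_functions \<Omega>"
  shows "\<phi> \<in> L"
proof -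
  have "compact (\<phi> ` closure \<Omega>)"
    using test_function_continuous[OF assms] bounded_domain
    by (intro compact_continuous_image) (auto intro: continuous_on_subset)
  then have "bounded (\<phi> ` closure \<Omega>)"
    by (rule compact_imp_bounded)
  then obtain B where B: "\<And>x. x \<in> closure \<Omega> \<Longrightarrow> cmod (\<phi> x) \<le> B"
    unfolding bounded_iff by blast
  have "cmod (\<phi> x) \<le> B" if "x \<in> \<Omega>" for x
    using that closure_subset[of \<Omega>] by (intro B) blast
  then show ?thesis
    using bounded_in_orlicz_space[OF M domain_lmeasurable] test_function_measurable[OF assms] by blast
qed

lemma smooth_approximableE:
  assumes "smooth_approximable f" "\<epsilon> > 0"
  obtains \<phi> where "\<phi> \<in> smooth_algebra" "\<phi> \<in> test_functions \<Omega>"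
    "lnorm (\<lambda>x. f x - \<phi> x) < ennreal \<epsilon>"
  using assms unfolding smooth_approximable_def by blast

lemma smooth_approximable_add:
  assumes f: "smooth_approximable f" and g: "smooth_approximable g"
  shows "smooth_approximable (\<lambda>x. f x + g x)"
  unfolding smooth_approximable_def
proof (intro conjI allI impI)
  have [measurable]: "f \<in> X" "g \<in> X"
    using f g by (auto simp: smooth_approximable_def)
  show "(\<lambda>x. f x + g x) \<in> X"
    by measurable
  fix \<epsilon> :: real assume "\<epsilon> > 0"
  then have "\<epsilon>/2 > 0"
    by simp
  obtain \<phi> where
    \<phi>: "\<phi> \<in> smooth_algebra" "\<phi> \<in> test_functions \<Omega>" "lnorm (\<lambda>x. f x - \<phi> x) < ennreal (\<epsilon>/2)"
    using smooth_approximableE[OF f \<open>\<epsilon>/2 > 0\<close>] .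
  obtain \<psi> where
    \<psi>: "\<psi> \<in> smooth_algebra" "\<psi> \<in> test_functions \<Omega>" "lnorm (\<lambda>x. g x - \<psi> x) < ennreal (\<epsilon>/2)"
    using smooth_approximableE[OF g \<open>\<epsilon>/2 > 0\<close>] .
  note [measurable] = test_function_measurable[OF \<phi>(2)] test_function_measurable[OF \<psi>(2)]
  have alg: "(\<lambda>x. \<phi> x + \<psi> x) \<in> smooth_algebra"
    using \<phi> \<psi> by (intro smooth_algebra.add)
  obtain C where C: "compact C" "C \<subseteq> \<Omega>" "\<And>x. x \<notin> C \<Longrightarrow> \<phi> x = 0"
    by (rule test_function_supportE[OF \<phi>(2)]) blast
  obtain D where D: "compact D" "D \<subseteq> \<Omega>" "\<And>x. x \<notin> D \<Longrightarrow> \<psi> x = 0"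
    by (rule test_function_supportE[OF \<psi>(2)]) blast
  have test: "(\<lambda>x. \<phi> x + \<psi> x) \<in> test_functions \<Omega>"
    by (rule smooth_algebra_test_function[OF alg, of "C \<union> D"])
       (use C(1,2) D(1,2) in \<open>auto simp: C(3) D(3)\<close>)
  have "lnorm (\<lambda>x. f x + g x - (\<phi> x + \<psi> x)) \<le> lnorm (\<lambda>x. f x - \<phi> x) + lnorm (\<lambda>x. g x - \<psi> x)"
    by (rule abs_orlicz_norm_add) (auto simp: norm_diff_triangle_ineq)
  also have "\<dots> < ennreal (\<epsilon>/2) + ennreal (\<epsilon>/2)"
    using \<phi> \<psi> by (intro ennreal_add_le_less) auto
  finally have "lnorm (\<lambda>x. f x + g x - (\<phi> x + \<psi> x)) < ennreal \<epsilon>"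
    using \<open>\<epsilon> > 0\<close> by (simp flip: ennreal_plus)
  with alg test show "\<exists>h\<in>smooth_algebra \<inter> test_functions \<Omega>. lnorm (\<lambda>x. f x + g x - h x) < ennreal \<epsilon>"
    by (intro bexI[of _ "\<lambda>x. \<phi> x + \<psi> x"]) auto
qed

lemma smooth_approximable_scale:
  assumes f: "smooth_approximable f"
  shows "smooth_approximable (\<lambda>x. c * f x)"
  unfolding smooth_approximable_def
proof (intro conjI allI impI)
  have [measurable]: "f \<in> X"
    using f by (auto simp: smooth_approximable_def)
  show "(\<lambda>x. c * f x) \<in> X"
    by measurable
  fix \<epsilon> :: real assume \<epsilon>: "\<epsilon> > 0"
  define e where "e = \<epsilon> / (cmod c + 1)"
  have e: "e > 0" "cmod c * e < \<epsilon>"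
    using \<epsilon> norm_ge_zero[of c] by (auto simp: e_def field_simps add_pos_nonneg add_nonneg_pos)
  obtain \<phi> where
    \<phi>: "\<phi> \<in> smooth_algebra" "\<phi> \<in> test_functions \<Omega>" "lnorm (\<lambda>x. f x - \<phi> x) < ennreal e"
    using smooth_approximableE[OF f e(1)] .
  note [measurable] = test_function_measurable[OF \<phi>(2)]
  have alg: "(\<lambda>x. c * \<phi> x) \<in> smooth_algebra"
    using \<phi> by (intro smooth_algebra.mult smooth_algebra.const)
  obtain C where C: "compact C" "C \<subseteq> \<Omega>" "\<And>x. x \<notin> C \<Longrightarrow> \<phi> x = 0"
    by (rule test_function_supportE[OF \<phi>(2)]) blast
  have test: "(\<lambda>x. c * \<phi> x) \<in> test_functions \<Omega>"
    by (rule smooth_algebra_test_function[OF alg C(1,2)]) (simp add: C(3))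
  have "lnorm (\<lambda>x. c * (f x - \<phi> x)) \<le> ennreal (cmod c) * lnorm (\<lambda>x. f x - \<phi> x)"
    by (rule abs_orlicz_norm_scale) measurable
  also have "\<dots> \<le> ennreal (cmod c) * ennreal e"
    using \<phi> by (intro mult_left_mono) auto
  also have "\<dots> < ennreal \<epsilon>"
    using e \<epsilon> by (simp flip: ennreal_mult add: ennreal_less_iff)
  finally have "lnorm (\<lambda>x. c * f x - c * \<phi> x) < ennreal \<epsilon>"
    by (simp add: algebra_simps)
  with alg test show "\<exists>h\<in>smooth_algebra \<inter> test_functions \<Omega>. lnorm (\<lambda>x. c * f x - h x) < ennreal \<epsilon>"
    by (intro bexI[of _ "\<lambda>x. c * \<phi> x"]) auto
qed

text \<open>The finite norm of the constant 1 turns a small uniform bound into a small norm.\<close>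

lemma lnorm_small_of_sup:
  assumes "\<epsilon> > 0"
  obtains e :: real where "e > 0" "\<And>f. (\<And>x. x \<in> \<Omega> \<Longrightarrow> cmod (f x) \<le> e) \<Longrightarrow> lnorm f < ennreal \<epsilon>"
proof -
  define K where "K = enn2real (lnorm (\<lambda>x. 1))"
  define e where "e = \<epsilon> / (K + 1)"
  have "K \<ge> 0"
    by (simp add: K_def)
  with assms have e: "e > 0" "e * K < \<epsilon>"
    by (auto simp: e_def field_simps)
  show ?thesis
  proof (rule that[OF e(1)])
    fix f assume "\<And>x. x \<in> \<Omega> \<Longrightarrow> cmod (f x) \<le> e"
    then have "lnorm f \<le> ennreal (e * K)"
      unfolding K_def using e by (intro abs_orlicz_norm_le_sup[OF M domain_lmeasurable]) auto
    also have "\<dots> < ennreal \<epsilon>"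
      using e assms by (intro ennreal_lessI)
    finally show "lnorm f < ennreal \<epsilon>" .
  qed
qed

lemma smooth_approximable_uniform_limit:
  assumes f[measurable]: "f \<in> X"
    and appr: "\<And>e::real. e > 0 \<Longrightarrow> \<exists>g. smooth_approximable g \<and> (\<forall>x\<in>\<Omega>. cmod (f x - g x) \<le> e)"
  shows "smooth_approximable f"
  unfolding smooth_approximable_def
proof (intro conjI allI impI f)
  fix \<epsilon> :: real assume \<epsilon>: "\<epsilon> > 0"
  then obtain e where e: "e > 0" "\<And>f. (\<And>x. x \<in> \<Omega> \<Longrightarrow> cmod (f x) \<le> e) \<Longrightarrow> lnorm f < ennreal (\<epsilon>/2)"
    using lnorm_small_of_sup[of "\<epsilon>/2"] by auto
  then obtain g where g: "smooth_approximable g" "\<And>x. x \<in> \<Omega> \<Longrightarrow> cmod (f x - g x) \<le> e"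
    using appr by blast
  obtain \<phi> where
    \<phi>: "\<phi> \<in> smooth_algebra" "\<phi> \<in> test_functions \<Omega>" "lnorm (\<lambda>x. g x - \<phi> x) < ennreal (\<epsilon>/2)"
    using smooth_approximableE[OF g(1) half_gt_zero[OF \<epsilon>]] .
  have [measurable]: "g \<in> X" "\<phi> \<in> X"
    using g \<phi> test_function_measurable by (auto simp: smooth_approximable_def)
  have "lnorm (\<lambda>x. f x - \<phi> x) \<le> lnorm (\<lambda>x. f x - g x) + lnorm (\<lambda>x. g x - \<phi> x)"
    by (rule abs_orlicz_norm_add) (auto intro: norm_diff_triangle_le)
  also have "\<dots> < ennreal (\<epsilon>/2) + ennreal (\<epsilon>/2)"
    using \<phi> e(2)[of "\<lambda>x. f x - g x"] g by (intro ennreal_add_le_less) (auto intro: less_imp_le)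
  finally have "lnorm (\<lambda>x. f x - \<phi> x) < ennreal \<epsilon>"
    using \<epsilon> by (simp flip: ennreal_plus)
  with \<phi> show "\<exists>\<phi>\<in>smooth_algebra \<inter> test_functions \<Omega>. lnorm (\<lambda>x. f x - \<phi> x) < ennreal \<epsilon>"
    by blast
qed

text \<open>Regularity of the measure encloses \<open>E\<close> between a compact \<open>T\<close>
  and an open \<open>U\<close>. The smooth function is within \<open>e\<close> of 1 on
  \<open>T\<close> and vanishes off \<open>U\<close>; on the remaining set \<open>D\<close> the
  difference is at most 1, and \<open>D\<close> has small measure, hence small norm.\<close>

lemma smooth_approximable_indicator:
  assumes E: "E \<in> sets lebesgue" "E \<subseteq> \<Omega>"
  shows "smooth_approximable (indicator E)"
  unfolding smooth_approximable_def
proof (intro conjI allI impI)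
  show ind: "indicator E \<in> X"
    using E by (intro borel_measurable_indicator) (simp add: sets_restrict_space_iff domain_sets)
  fix \<epsilon> :: real assume \<epsilon>: "\<epsilon> > 0"
  then obtain e where e: "e > 0" "\<And>f. (\<And>x. x \<in> \<Omega> \<Longrightarrow> cmod (f x) \<le> e) \<Longrightarrow> lnorm f < ennreal (\<epsilon>/2)"
    using lnorm_small_of_sup[of "\<epsilon>/2"] by auto
  obtain \<eta> where \<eta>: "\<eta> > 0"
    "\<And>E. E \<in> sets lebesgue \<Longrightarrow> E \<subseteq> \<Omega> \<Longrightarrow> measure lebesgue E < \<eta> \<Longrightarrow> orlicz_norm M \<Omega> (indicator E) < ennreal (\<epsilon>/2)"
    using indicator_small[of "\<epsilon>/2"] \<epsilon> by auto
  obtain T where T: "closed T" "T \<subseteq> E" "E - T \<in> lmeasurable" "emeasure lebesgue (E - T) < ennreal (\<eta>/2)"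
    using sets_lebesgue_inner_closed[OF E(1), of "\<eta>/2"] \<eta> by auto
  obtain U where U: "open U" "E \<subseteq> U" "U - E \<in> lmeasurable" "emeasure lebesgue (U - E) < ennreal (\<eta>/2)"
    using sets_lebesgue_outer_open[OF E(1), of "\<eta>/2"] \<eta> by auto
  have "compact T"
    using T E bounded_domain by (auto simp: compact_eq_bounded_closed intro: bounded_subset)
  have TU: "T \<subseteq> U \<inter> \<Omega>" and UO: "open (U \<inter> \<Omega>)"
    using T U E open_domain by auto
  obtain \<phi> C where \<phi>: "(\<lambda>x. complex_of_real (\<phi> x)) \<in> smooth_algebra" "compact C" "C \<subseteq> U \<inter> \<Omega>"
    "\<And>x. 0 \<le> \<phi> x" "\<And>x. \<phi> x \<le> 1" "\<And>x. x \<notin> C \<Longrightarrow> \<phi> x = 0" "\<And>x. x \<in> T \<Longrightarrow> 1 - \<phi> x \<le> e"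
    by (rule smooth_approximate_Urysohn[OF \<open>compact T\<close> UO TU e(1)]) blast
  have test: "(\<lambda>x. complex_of_real (\<phi> x)) \<in> test_functions \<Omega>"
    using \<phi> by (intro smooth_algebra_test_function[of _ C]) auto
  note [measurable] = test_function_measurable[OF test] ind
  define D where "D = U \<inter> \<Omega> - T"
  have D: "D \<in> sets lebesgue" "D \<subseteq> \<Omega>"
    using U T open_domain by (auto simp: D_def)
  have ind_D[measurable]: "indicator D \<in> X"
    using D by (intro borel_measurable_indicator) (simp add: sets_restrict_space_iff domain_sets)
  have "D \<subseteq> (E - T) \<union> (U - E)"
    by (auto simp: D_def)
  then have "emeasure lebesgue D \<le> emeasure lebesgue ((E - T) \<union> (U - E))"
    using T U by (intro emeasure_mono sets.Un) (auto dest: fmeasurableD)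
  also have "\<dots> \<le> emeasure lebesgue (E - T) + emeasure lebesgue (U - E)"
    using T U by (intro emeasure_subadditive) (auto dest: fmeasurableD)
  also have "\<dots> < ennreal (\<eta>/2) + ennreal (\<eta>/2)"
    using T U by (intro ennreal_add_le_less) auto
  finally have "emeasure lebesgue D < ennreal \<eta>"
    using \<eta> by (simp flip: ennreal_plus)
  moreover have D_meas: "D \<in> lmeasurable"
    using D bounded_domain by (intro bounded_set_imp_lmeasurable) (auto intro: bounded_subset)
  ultimately have "measure lebesgue D < \<eta>"
    using \<eta>(1) emeasure_eq_measure2[OF D_meas] by (simp add: ennreal_less_iff del: emeasure_completion)
  then have "orlicz_norm M \<Omega> (indicator D) < ennreal (\<epsilon>/2)"
    using \<eta>(2) D by blast
  moreover have "indicator D \<in> L"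
    by (rule bounded_in_orlicz_space[OF M domain_lmeasurable ind_D, of 1]) (auto simp: indicator_def)
  ultimately have D_small: "lnorm (indicator D) < ennreal (\<epsilon>/2)"
    by (simp add: abs_orlicz_norm_eq)
  have "lnorm (\<lambda>x. indicator E x - complex_of_real (\<phi> x)) \<le> lnorm (indicator D) + lnorm (\<lambda>x. complex_of_real e)"
  proof (rule abs_orlicz_norm_add)
    fix x assume x: "x \<in> \<Omega>"
    have "cmod (indicator E x - complex_of_real (\<phi> x)) = \<bar>indicator E x - \<phi> x\<bar>"
      by (metis norm_of_real of_real_diff of_real_indicator)
    also have "\<dots> \<le> indicator D x + e"
    proof (cases "x \<in> T")
      case True
      then show ?thesis
        using T \<phi>(5)[of x] \<phi>(7)[of x] by (auto simp: indicator_def)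
    next
      case False
      show ?thesis
      proof (cases "x \<in> D")
        case True
        then show ?thesis
          using \<phi>(4)[of x] \<phi>(5)[of x] e(1) by (auto simp: indicator_def)
      next
        case False
        with \<open>x \<notin> T\<close> x have "x \<notin> E" "x \<notin> C"
          using U \<phi>(3) by (auto simp: D_def)
        then show ?thesis
          using \<phi>(6)[of x] e(1) by (auto simp: indicator_def)
      qed
    qed
    finally show "cmod (indicator E x - complex_of_real (\<phi> x)) \<le> cmod (indicator D x) + cmod (complex_of_real e)"
      using e(1) by (cases "x \<in> D") simp_all
  qed measurable
  also have "\<dots> < ennreal (\<epsilon>/2) + ennreal (\<epsilon>/2)"
    using D_small e(2)[of "\<lambda>x. complex_of_real e"] e(1) by (intro ennreal_add_le_less) auto
  finally have "lnorm (\<lambda>x. indicator E x - complex_of_real (\<phi> x)) < ennreal \<epsilon>"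
    using \<epsilon> by (simp flip: ennreal_plus)
  with \<phi>(1) test show "\<exists>\<phi>\<in>smooth_algebra \<inter> test_functions \<Omega>. lnorm (\<lambda>x. indicator E x - \<phi> x) < ennreal \<epsilon>"
    by (intro bexI[of _ "\<lambda>x. complex_of_real (\<phi> x)"] IntI)
qed

lemma smooth_approximable_const_on: "smooth_approximable (\<lambda>x. c * indicator \<Omega> x)"
  by (intro smooth_approximable_scale smooth_approximable_indicator domain_sets order_refl)

lemma smooth_approximable_sum:
  assumes "finite I" "\<And>i. i \<in> I \<Longrightarrow> smooth_approximable (f i)"
  shows "smooth_approximable (\<lambda>x. \<Sum>i\<in>I. f i x)"
  using assms smooth_approximable_const_on[of 0]
  by (induction I) (auto intro: smooth_approximable_add)

text \<open>Layer cake: the integer part of \<open>m f\<close> counts the levels \<open>j / m\<close> below \<open>f\<close>.\<close>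

lemma smooth_approximable_nonneg:
  fixes f :: "real^'n \<Rightarrow> real"
  assumes [measurable]: "f \<in> borel_measurable (lebesgue_on \<Omega>)"
    and f: "\<And>x. x \<in> \<Omega> \<Longrightarrow> 0 \<le> f x" "\<And>x. x \<in> \<Omega> \<Longrightarrow> f x \<le> B"
  shows "smooth_approximable (\<lambda>x. complex_of_real (f x))"
proof (rule smooth_approximable_uniform_limit)
  fix e :: real assume "e > 0"
  then obtain m :: nat where m: "m > 0" "1 / real m < e"
    using reals_Archimedean[of e] by (metis inverse_eq_divide zero_less_Suc)
  \<comment> \<open>No level above \<open>real m * B\<close> is reached on the domain. The sum in
    \<open>g\<close> starts at level 1, so that the count at a point is exactly the integer
    part.\<close>
  define n where "n = nat \<lfloor>real m * B\<rfloor>"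
  define A where "A j = {x \<in> \<Omega>. real j \<le> real m * f x}" for j
  define g where "g x = (\<Sum>j=1..n. complex_of_real (1 / real m) * indicator (A j) x)" for x
  have "A j \<in> sets (lebesgue_on \<Omega>)" for j
  proof -
    have "A j = {x \<in> space (lebesgue_on \<Omega>). real j \<le> real m * f x}"
      by (simp add: A_def space_restrict_space)
    also have "\<dots> \<in> sets (lebesgue_on \<Omega>)"
      by measurable
    finally show ?thesis .
  qed
  then have "smooth_approximable (indicator (A j))" for j
    by (intro smooth_approximable_indicator) (auto simp: sets_restrict_space_iff domain_sets)
  then have "smooth_approximable g"
    unfolding g_def[abs_def] by (intro smooth_approximable_sum smooth_approximable_scale) auto
  moreover have "cmod (complex_of_real (f x) - g x) \<le> e" if x: "x \<in> \<Omega>" for x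
  proof -
    define t where "t = nat \<lfloor>real m * f x\<rfloor>"
    have nonneg: "0 \<le> real m * f x"
      using f x by simp
    have "real m * f x \<le> real m * B"
      using f x by (intro mult_left_mono) auto
    then have "t \<le> n"
      unfolding t_def n_def by (intro nat_mono floor_mono)
    have iff: "real j \<le> real m * f x \<longleftrightarrow> j \<le> t" for j
      using nonneg by (simp add: t_def le_nat_iff le_floor_iff)
    have "(\<Sum>j=1..n. indicator (A j) x) = (\<Sum>j=1..n. if j \<le> t then 1 else (0::real))"
      using x by (intro sum.cong) (auto simp: A_def iff indicator_def)
    also have "\<dots> = real (card {j\<in>{1..n}. j \<le> t})"
      by (simp add: sum.If_cases Int_def conj_commute)
    also have "{j\<in>{1..n}. j \<le> t} = {1..t}"
      using \<open>t \<le> n\<close> by auto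
    finally have sum: "(\<Sum>j=1..n. indicator (A j) x) = real t"
      by simp
    have "g x = complex_of_real (1 / real m * (\<Sum>j=1..n. indicator (A j) x))"
      by (simp only: g_def of_real_mult of_real_sum of_real_indicator sum_distrib_left)
    then have "complex_of_real (f x) - g x = complex_of_real (f x - real t / real m)"
      unfolding sum by simp
    then have "cmod (complex_of_real (f x) - g x) = \<bar>f x - real t / real m\<bar>"
      by (simp only: norm_of_real)
    also have "\<dots> = (real m * f x - real t) / real m"
    proof -
      have "real t \<le> real m * f x"
        using iff by blast
      with m show ?thesis
        by (simp add: field_simps abs_if)
    qed
    also have "\<dots> \<le> 1 / real m"
    proof (rule divide_right_mono)
      show "real m * f x - real t \<le> 1"
        using iff[of "Suc t"] by simp
    qed simp
    finally show ?thesis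
      using m by simp
  qed
  ultimately show "\<exists>g. smooth_approximable g \<and> (\<forall>x\<in>\<Omega>. cmod (complex_of_real (f x) - g x) \<le> e)"
    by blast
qed measurable

lemma smooth_approximable_real:
  fixes f :: "real^'n \<Rightarrow> real"
  assumes [measurable]: "f \<in> borel_measurable (lebesgue_on \<Omega>)" and f: "\<And>x. x \<in> \<Omega> \<Longrightarrow> \<bar>f x\<bar> \<le> B"
  shows "smooth_approximable (\<lambda>x. complex_of_real (f x))"
proof (rule smooth_approximable_uniform_limit)
  fix e :: real assume "e > 0"
  \<comment> \<open>Adding \<open>B\<close> makes the function nonnegative. The correction by
    \<open>B\<close> times the indicator restores \<open>f\<close> on \<open>\<Omega>\<close> only,
    so the uniform limit lemma is used with error 0 there.\<close>
  have "smooth_approximable (\<lambda>x. complex_of_real (f x + B) + complex_of_real (- B) * indicator \<Omega> x)"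
  proof (intro smooth_approximable_add smooth_approximable_const_on smooth_approximable_nonneg)
    show "0 \<le> f x + B" "f x + B \<le> 2 * B" if "x \<in> \<Omega>" for x
      using f[OF that] by auto
  qed measurable
  with \<open>e > 0\<close> show "\<exists>g. smooth_approximable g \<and> (\<forall>x\<in>\<Omega>. cmod (complex_of_real (f x) - g x) \<le> e)"
    by (intro exI[of _ "\<lambda>x. complex_of_real (f x + B) + complex_of_real (- B) * indicator \<Omega> x"]) auto
qed measurable

lemma smooth_approximable_bounded:
  assumes [measurable]: "f \<in> X" and f: "\<And>x. x \<in> \<Omega> \<Longrightarrow> cmod (f x) \<le> B"
  shows "smooth_approximable f"
proof -
  have "smooth_approximable (\<lambda>x. complex_of_real (Re (f x)) + \<i> * complex_of_real (Im (f x)))"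
  proof (intro smooth_approximable_add smooth_approximable_scale smooth_approximable_real)
    show "\<bar>Re (f x)\<bar> \<le> B" "\<bar>Im (f x)\<bar> \<le> B" if "x \<in> \<Omega>" for x
      using f[OF that] abs_Re_le_cmod[of "f x"] abs_Im_le_cmod[of "f x"] by auto
  qed measurable
  then show ?thesis
    by (simp add: complex_eq[symmetric])
qed

end

section \<open>Averages over shifts\<close>

text \<open>Lebesgue measure is the completion of its Borel restriction, so the real and imaginary
  parts of the zero extension have Borel representatives.\<close>

lemma lebesgue_on_ex_borel_measurable:
  fixes f :: "real^'n \<Rightarrow> complex"
  assumes S: "S \<in> sets lebesgue" and f: "f \<in> borel_measurable (lebesgue_on S)"
  obtains h where "h \<in> borel_measurable borel" "AE x in lebesgue_on S. f x = h x"
proof -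
  have [measurable]: "(\<lambda>x. if x \<in> S then f x else 0) \<in> borel_measurable lebesgue"
    using borel_measurable_if_I[OF f S] .
  have "(\<lambda>x. Re (if x \<in> S then f x else 0)) \<in> borel_measurable lebesgue"
    "(\<lambda>x. Im (if x \<in> S then f x else 0)) \<in> borel_measurable lebesgue"
    by measurable
  then obtain g1 g2 where g[measurable]: "g1 \<in> borel_measurable lborel" "g2 \<in> borel_measurable lborel"
    and AE1: "AE x in lborel. Re (if x \<in> S then f x else 0) = g1 x"
    and AE2: "AE x in lborel. Im (if x \<in> S then f x else 0) = g2 x"
    using completion_ex_borel_measurable_real by blast
  show thesis
  proof
    show "(\<lambda>x. complex_of_real (g1 x) + \<i> * complex_of_real (g2 x)) \<in> borel_measurable borel"
      using g by simp
    have "AE x in lebesgue. Re (if x \<in> S then f x else 0) = g1 x \<and> Im (if x \<in> S then f x else 0) = g2 x"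
      using AE1 AE2 by (intro AE_completion) auto
    then have "AE x in lebesgue. x \<in> S \<longrightarrow> f x = complex_of_real (g1 x) + \<i> * complex_of_real (g2 x)"
      by eventually_elim (auto simp: complex_eq_iff)
    then show "AE x in lebesgue_on S. f x = complex_of_real (g1 x) + \<i> * complex_of_real (g2 x)"
      using S by (subst AE_restrict_space_iff) auto
  qed
qed

lemma orlicz_space_AE_cong:
  assumes "f \<in> orlicz_space M \<Omega>" "h \<in> borel_measurable (lebesgue_on \<Omega>)"
    and AE: "AE x in lebesgue_on \<Omega>. f x = h x"
  shows "h \<in> orlicz_space M \<Omega>"
proof -
  have "(\<integral>\<^sup>+x. ennreal (cmod (h x) * cmod (v x)) \<partial>lebesgue_on \<Omega>)
      = (\<integral>\<^sup>+x. ennreal (cmod (f x) * cmod (v x)) \<partial>lebesgue_on \<Omega>)" for v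
    by (rule nn_integral_cong_AE) (use AE in eventually_elim, simp)
  with assms show ?thesis
    by (simp add: orlicz_space_iff)
qed

context orlicz_cell
begin

text \<open>
  The average of all shifts by vectors of a set of positive measure is bounded, because the
  integral of a shifted function over a whole period is its \<open>L\<^sup>1\<close> norm.
\<close>

lemma bounded_approximation_borel:
  assumes h_borel: "h \<in> borel_measurable borel" and hL: "h \<in> L"
    and lim: "((\<lambda>\<delta>. lnorm (\<lambda>x. shift \<Omega> a \<delta> h x - h x)) \<longlongrightarrow> 0) (at 0)" and \<epsilon>: "\<epsilon> > 0"
  obtains g B where "g \<in> borel_measurable (lebesgue_on \<Omega>)" "\<And>x. cmod (g x) \<le> B"
    "lnorm (\<lambda>x. h x - g x) \<le> ennreal \<epsilon>"
proof -
  let ?d = "diameter \<Omega>"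
  have "\<forall>\<^sub>F \<delta> in at 0. lnorm (\<lambda>x. shift \<Omega> a \<delta> h x - h x) < ennreal \<epsilon>"
    using lim \<epsilon> by (simp add: ennreal_tendsto_0_iff)
  then obtain r where r: "r > 0"
    "\<And>\<delta>. \<delta> \<noteq> 0 \<Longrightarrow> norm \<delta> < r \<Longrightarrow> lnorm (\<lambda>x. shift \<Omega> a \<delta> h x - h x) < ennreal \<epsilon>"
    by (auto simp: eventually_at)
  \<comment> \<open>Shift vectors are written \<open>y - a\<close> with \<open>y\<close> in
    \<open>C\<close>: then \<open>\<tau> (y - a) x\<close> is symmetric in \<open>x\<close> and
    \<open>y\<close>, and \<open>y\<close> runs inside the cell. The open box excludes the corner
    \<open>a\<close>, hence the zero shift.\<close>
  define C where "C = ball a r \<inter> box a (a + vec ?d)"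
  have box: "box a (a + vec ?d) \<noteq> {}"
    using diameter_pos by (simp add: interval_ne_empty_cart)
  have "a \<in> ball a r \<inter> closure (box a (a + vec ?d))"
    using r diameter_pos by (simp add: closure_box[OF box] mem_box_cart)
  then have "C \<noteq> {}"
    unfolding C_def using open_Int_closure_eq_empty[of "ball a r" "box a (a + vec ?d)"] by blast
  have "open C"
    by (auto simp: C_def)
  have [measurable]: "C \<in> sets borel"
    using \<open>open C\<close> by simp
  have C_cell: "C \<subseteq> Q"
    by (auto simp: C_def cell_def mem_box_cart less_imp_le)
  have C_shift: "lnorm (\<lambda>x. shift \<Omega> a (y - a) h x - h x) < ennreal \<epsilon>" if "y \<in> C" for y
  proof (rule r)
    have "\<not> y $ i \<le> a $ i" for i
      using that by (auto simp: C_def mem_box_cart not_le)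
    then show "y - a \<noteq> 0"
      by auto
    show "norm (y - a) < r"
      using that by (simp add: C_def dist_norm norm_minus_commute)
  qed
  have C_pos: "emeasure lborel C \<noteq> 0"
    using \<open>open C\<close> \<open>C \<noteq> {}\<close> open_not_negligible[of C] by (auto simp: negligible_iff_null_sets null_sets_def)
  have C_fin: "emeasure lborel C \<noteq> \<infinity>"
  proof -
    have "emeasure lborel C \<le> emeasure lborel (ball a r)"
      by (intro emeasure_mono) (auto simp: C_def)
    also have "\<dots> < \<infinity>"
      by (rule emeasure_lborel_ball_finite)
    finally show ?thesis
      by simp
  qed
  define P where "P = uniform_measure lborel C"
  have P_UNIV: "emeasure P UNIV = 1"
    using C_pos C_fin by (simp add: P_def ennreal_divide_self less_top)
  have sets_P[measurable_cong]: "sets P = sets borel"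
    by (simp add: P_def)
  have space_P: "space P = UNIV"
    by (simp add: P_def)
  interpret P: finite_measure P
    by (rule finite_measureI) (simp add: space_P P_UNIV)
  have measure_P: "measure P UNIV = 1"
    by (simp add: measure_def P_UNIV)
  interpret Om: finite_measure "lebesgue_on \<Omega>"
    by (rule finite_measureI)
       (use emeasure_lebesgue_on_finite[OF domain_lmeasurable] in \<open>simp add: space_restrict_space\<close>)
  interpret OmP: pair_sigma_finite "lebesgue_on \<Omega>" P ..

  define H where "H = zero_ext h"
  have [measurable]: "\<Omega> \<in> sets borel"
    using open_domain by simp
  have [measurable]: "H \<in> borel_measurable borel"
    unfolding H_def zero_ext_def[abs_def] using h_borel by measurable
  have H_meas: "(\<lambda>y. H (\<tau> (y - a) x)) \<in> borel_measurable borel" for x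
    by measurable
  have [measurable]: "h \<in> borel_measurable (lebesgue_on \<Omega>)"
    using hL by (simp add: orlicz_space_iff)
  have id: "(\<lambda>x. x) \<in> borel_measurable (lebesgue_on \<Omega>)"
    by (rule measurable_restrict_space1, rule measurable_completion) simp
  have shift_H: "shift \<Omega> a (y - a) h x = H (\<tau> (y - a) x)" for x y
    by (simp add: shift_eq H_def)
  have fst[measurable]: "(\<lambda>z. fst z) \<in> borel_measurable (lebesgue_on \<Omega> \<Otimes>\<^sub>M P)"
    by (rule measurable_compose[OF measurable_fst id])
  have snd[measurable]: "(\<lambda>z. snd z) \<in> borel_measurable (lebesgue_on \<Omega> \<Otimes>\<^sub>M P)"
    using measurable_snd[of "lebesgue_on \<Omega>" P] by (simp add: measurable_cong_sets[OF refl sets_P])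
  \<comment> \<open>Here \<open>H\<close> must be Borel: a preimage of a Lebesgue null set under a
    Borel map need not be measurable.\<close>
  have joint[measurable]: "(\<lambda>z. H (\<tau> (snd z - a) (fst z))) \<in> borel_measurable (lebesgue_on \<Omega> \<Otimes>\<^sub>M P)"
    by measurable
  define g where "g x = (\<integral>y. H (\<tau> (y - a) x) \<partial>P)" for x
  have g_meas: "g \<in> borel_measurable (lebesgue_on \<Omega>)"
  proof -
    have "(\<lambda>(x, y). H (\<tau> (y - a) x)) \<in> borel_measurable (lebesgue_on \<Omega> \<Otimes>\<^sub>M P)"
      using joint by (simp add: case_prod_unfold)
    from P.borel_measurable_lebesgue_integral[OF this] show ?thesis
      by (simp add: g_def[abs_def])
  qed

  define B where "B = (\<integral>\<^sup>+x. ennreal (cmod (h x)) \<partial>lebesgue_on \<Omega>) / emeasure lborel C"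
  have "B < \<infinity>"
    using nn_integral_orlicz_space_finite[OF M domain_lmeasurable hL] C_pos
    by (auto simp: B_def less_top[symmetric] ennreal_divide_eq_top_iff)
  have H_le: "(\<integral>\<^sup>+y. ennreal (cmod (H (\<tau> (y - a) x))) \<partial>P) \<le> B" for x
  proof -
    have "(\<integral>\<^sup>+y. ennreal (cmod (H (\<tau> (y - a) x))) \<partial>P)
       = (\<integral>\<^sup>+y. ennreal (cmod (H (\<tau> (y - a) x))) * indicator C y \<partial>lborel) / emeasure lborel C"
      unfolding P_def using H_meas by (intro nn_integral_uniform_measure) auto
    \<comment> \<open>By symmetry, \<open>x\<close> becomes the shift parameter and \<open>y\<close>
      the point. Enlarging \<open>C\<close> to the whole cell then allows translation invariance,
      which removes the dependence on \<open>x\<close>.\<close>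
    also have "(\<integral>\<^sup>+y. ennreal (cmod (H (\<tau> (y - a) x))) * indicator C y \<partial>lborel)
        \<le> (\<integral>\<^sup>+y. ennreal (cmod (H (\<tau> (x - a) y))) * indicator Q y \<partial>lborel)"
      using C_cell by (intro nn_integral_mono) (auto simp: indicator_def algebra_simps)
    also have "\<dots> = (\<integral>\<^sup>+y. ennreal (cmod (H (\<tau> (x - a) y))) \<partial>lebesgue_on Q)"
      by (simp add: nn_integral_restrict_space nn_integral_completion)
    also have "\<dots> = (\<integral>\<^sup>+y. ennreal (cmod (H y)) \<partial>lebesgue_on Q)"
    proof (rule nn_integral_wrap_translation[OF diameter_pos, where f = "\<lambda>y. ennreal (cmod (H y))"])
      have "H \<in> borel_measurable (lebesgue_on Q)"
        unfolding H_def by (rule zero_ext_measurable) measurable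
      then show "(\<lambda>y. ennreal (cmod (H y))) \<in> borel_measurable (lebesgue_on Q)"
        by measurable
    qed
    also have "\<dots> = (\<integral>\<^sup>+x. ennreal (cmod (h x)) \<partial>lebesgue_on \<Omega>)"
      using domain_subset_cell
      by (intro nn_integral_lebesgue_on_superset domain_sets cell_sets) (auto simp: H_def zero_ext_def)
    finally show ?thesis
      by (simp add: B_def divide_right_mono_ennreal)
  qed
  have int: "integrable P (\<lambda>y. H (\<tau> (y - a) x))" for x
    using le_less_trans[OF H_le \<open>B < \<infinity>\<close>] H_meas
    by (intro integrableI_bounded) (auto simp: measurable_cong_sets[OF sets_P refl])
  have g_bound: "cmod (g x) \<le> enn2real B" for x
  proof -
    have "ennreal (cmod (g x)) \<le> B"
      unfolding g_def by (rule order_trans[OF integral_norm_bound_ennreal[OF int] H_le])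
    then show ?thesis
      using \<open>B < \<infinity>\<close> by (metis enn2real_ennreal enn2real_mono infinity_ennreal_def norm_ge_zero)
  qed

  \<comment> \<open>Minkowski's integral inequality by duality: for a fixed \<open>v\<close>, the
    norm of the averaged difference is at most the average of the norms. Since \<open>P\<close> has
    mass 1, \<open>h x\<close> can be brought under the integral.\<close>
  have "lnorm (\<lambda>x. h x - g x) \<le> ennreal \<epsilon>"
  proof (rule abs_orlicz_norm_least)
    fix v assume v[measurable]: "v \<in> borel_measurable (lebesgue_on \<Omega>)" and mod: "modular N \<Omega> v \<le> 1"
    have "(\<integral>\<^sup>+x. ennreal (cmod (h x - g x) * cmod (v x)) \<partial>lebesgue_on \<Omega>)
        \<le> (\<integral>\<^sup>+x. (\<integral>\<^sup>+y. ennreal (cmod (H (\<tau> (y - a) x) - h x) * cmod (v x)) \<partial>P) \<partial>lebesgue_on \<Omega>)"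
    proof (rule nn_integral_mono)
      fix x
      have "h x - g x = (\<integral>y. h x - H (\<tau> (y - a) x) \<partial>P)"
        using int[of x] by (subst Bochner_Integration.integral_diff) (auto simp: g_def space_P measure_P)
      then have "ennreal (cmod (h x - g x)) \<le> (\<integral>\<^sup>+y. ennreal (cmod (h x - H (\<tau> (y - a) x))) \<partial>P)"
        using integral_norm_bound_ennreal[of P "\<lambda>y. h x - H (\<tau> (y - a) x)"] int[of x] by simp
      then have "ennreal (cmod (h x - g x) * cmod (v x))
          \<le> (\<integral>\<^sup>+y. ennreal (cmod (h x - H (\<tau> (y - a) x))) \<partial>P) * ennreal (cmod (v x))"
        by (simp add: ennreal_mult mult_right_mono)
      also have "\<dots> = (\<integral>\<^sup>+y. ennreal (cmod (H (\<tau> (y - a) x) - h x) * cmod (v x)) \<partial>P)"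
        by (subst nn_integral_multc[symmetric]) (auto simp: ennreal_mult norm_minus_commute)
      finally show "ennreal (cmod (h x - g x) * cmod (v x))
          \<le> (\<integral>\<^sup>+y. ennreal (cmod (H (\<tau> (y - a) x) - h x) * cmod (v x)) \<partial>P)" .
    qed
    also have "\<dots> = (\<integral>\<^sup>+y. (\<integral>\<^sup>+x. ennreal (cmod (H (\<tau> (y - a) x) - h x) * cmod (v x)) \<partial>lebesgue_on \<Omega>) \<partial>P)"
    proof (rule OmP.Fubini'[symmetric])
      have [measurable]: "(\<lambda>z. h (fst z)) \<in> borel_measurable (lebesgue_on \<Omega> \<Otimes>\<^sub>M P)"
        "(\<lambda>z. v (fst z)) \<in> borel_measurable (lebesgue_on \<Omega> \<Otimes>\<^sub>M P)"
        by (rule measurable_compose[OF measurable_fst], measurable)+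
      show "(\<lambda>(x, y). ennreal (cmod (H (\<tau> (y - a) x) - h x) * cmod (v x)))
          \<in> borel_measurable (lebesgue_on \<Omega> \<Otimes>\<^sub>M P)"
        unfolding case_prod_unfold by measurable
    qed
    also have "\<dots> \<le> (\<integral>\<^sup>+y. ennreal \<epsilon> \<partial>P)"
    proof (rule nn_integral_mono_AE)
      have "AE y in P. y \<in> C"
        unfolding P_def by (intro AE_uniform_measureI) auto
      then show "AE y in P. (\<integral>\<^sup>+x. ennreal (cmod (H (\<tau> (y - a) x) - h x) * cmod (v x)) \<partial>lebesgue_on \<Omega>) \<le> ennreal \<epsilon>"
      proof eventually_elim
        case (elim y)
        have "(\<integral>\<^sup>+x. ennreal (cmod (shift \<Omega> a (y - a) h x - h x) * cmod (v x)) \<partial>lebesgue_on \<Omega>)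
            \<le> lnorm (\<lambda>x. shift \<Omega> a (y - a) h x - h x)"
          by (rule abs_orlicz_norm_upper[OF v mod])
        then show ?case
          using C_shift[OF elim] by (simp add: shift_H)
      qed
    qed
    also have "\<dots> = ennreal \<epsilon>"
      by (simp add: space_P P_UNIV)
    finally show "(\<integral>\<^sup>+x. ennreal (cmod (h x - g x) * cmod (v x)) \<partial>lebesgue_on \<Omega>) \<le> ennreal \<epsilon>" .
  qed
  with that g_meas g_bound show thesis
    by blast
qed

lemma bounded_approximation:
  assumes fL: "f \<in> L"
    and lim: "((\<lambda>\<delta>. lnorm (\<lambda>x. shift \<Omega> a \<delta> f x - f x)) \<longlongrightarrow> 0) (at 0)" and \<epsilon>: "\<epsilon> > 0"
  obtains g B where "g \<in> borel_measurable (lebesgue_on \<Omega>)" "\<And>x. cmod (g x) \<le> B"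
    "lnorm (\<lambda>x. f x - g x) \<le> ennreal \<epsilon>"
proof -
  have f[measurable]: "f \<in> borel_measurable (lebesgue_on \<Omega>)"
    using fL by (simp add: orlicz_space_iff)
  obtain h where h_borel: "h \<in> borel_measurable borel" and AE: "AE x in lebesgue_on \<Omega>. f x = h x"
    using lebesgue_on_ex_borel_measurable[OF domain_sets f] .
  have h[measurable]: "h \<in> borel_measurable (lebesgue_on \<Omega>)"
    by (rule measurable_restrict_space1, rule measurable_completion) (use h_borel in simp)
  have fh: "lnorm (\<lambda>x. f x - h x) = 0" and hf: "lnorm (\<lambda>x. h x - f x) = 0"
    by (rule abs_orlicz_norm_AE_zero, use AE in eventually_elim, simp)+
  \<comment> \<open>The exceptional null set moves with \<open>\<delta>\<close>. Closedness at
    distance 0, with \<open>w = f\<close>, avoids tracking it.\<close>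
  have "((\<lambda>\<delta>. lnorm (\<lambda>x. shift \<Omega> a \<delta> h x - h x)) \<longlongrightarrow> 0) (at 0)"
    using hf lim by (intro lnorm_shift_tendsto_closed[OF h] bexI[OF _ f]) auto
  with h_borel orlicz_space_AE_cong[OF fL h AE] \<epsilon> obtain g B where
    g: "g \<in> borel_measurable (lebesgue_on \<Omega>)" "\<And>x. cmod (g x) \<le> B" "lnorm (\<lambda>x. h x - g x) \<le> ennreal \<epsilon>"
    using bounded_approximation_borel by blast
  note [measurable] = g(1)
  have "lnorm (\<lambda>x. f x - g x) \<le> lnorm (\<lambda>x. f x - h x) + lnorm (\<lambda>x. h x - g x)"
    by (rule abs_orlicz_norm_add) (auto intro: norm_diff_triangle_le)
  then have "lnorm (\<lambda>x. f x - g x) \<le> ennreal \<epsilon>"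
    using g(3) fh by simp
  with that g show thesis
    by blast
qed

lemma G_space_iff:
  "f \<in> G_space M \<Omega> a \<longleftrightarrow> f \<in> L \<and> ((\<lambda>\<delta>. lnorm (\<lambda>x. shift \<Omega> a \<delta> f x - f x)) \<longlongrightarrow> 0) (at 0)"
proof -
  have "orlicz_norm M \<Omega> (\<lambda>x. shift \<Omega> a \<delta> f x - f x) = lnorm (\<lambda>x. shift \<Omega> a \<delta> f x - f x)" if "f \<in> L" for \<delta>
    using that by (intro abs_orlicz_norm_eq[symmetric] orlicz_space_diff shift_in_orlicz_space)
  then show ?thesis
    by (auto simp: G_space_def)
qed

end

section \<open>The two inclusions\<close>

context orlicz_cell_ac
begin

lemma closure_test_functions_subset:
  "seminorm_closure L (orlicz_norm M \<Omega>) (test_functions \<Omega>) \<subseteq> G_space M \<Omega> a"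
proof
  fix u assume u: "u \<in> seminorm_closure L (orlicz_norm M \<Omega>) (test_functions \<Omega>)"
  then have uL: "u \<in> L" and appr: "\<And>\<epsilon>::real. \<epsilon> > 0 \<Longrightarrow> \<exists>\<phi>\<in>test_functions \<Omega>. orlicz_norm M \<Omega> (\<lambda>x. u x - \<phi> x) < ennreal \<epsilon>"
    by (auto simp: seminorm_closure_def)
  have "u \<in> X"
    using uL by (simp add: orlicz_space_iff)
  then have "((\<lambda>\<delta>. lnorm (\<lambda>x. shift \<Omega> a \<delta> u x - u x)) \<longlongrightarrow> 0) (at 0)"
  proof (rule lnorm_shift_tendsto_closed)
    fix \<epsilon> :: real assume "\<epsilon> > 0"
    then obtain \<phi> where \<phi>: "\<phi> \<in> test_functions \<Omega>" "orlicz_norm M \<Omega> (\<lambda>x. u x - \<phi> x) < ennreal \<epsilon>"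
      using appr by blast
    have "lnorm (\<lambda>x. u x - \<phi> x) < ennreal \<epsilon>"
      using \<phi>(2) abs_orlicz_norm_eq[OF orlicz_space_diff[OF uL test_function_in_orlicz_space[OF \<phi>(1)]]] by simp
    moreover have "((\<lambda>\<delta>. lnorm (\<lambda>x. shift \<Omega> a \<delta> \<phi> x - \<phi> x)) \<longlongrightarrow> 0) (at 0)"
      using \<phi>(1) by (intro lnorm_shift_tendsto_continuous test_function_continuous) (auto simp: test_functions_def)
    ultimately show "\<exists>w\<in>X. lnorm (\<lambda>x. u x - w x) < ennreal \<epsilon> \<and>
        ((\<lambda>\<delta>. lnorm (\<lambda>x. shift \<Omega> a \<delta> w x - w x)) \<longlongrightarrow> 0) (at 0)"
      using test_function_measurable[OF \<phi>(1)] by blast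
  qed
  with uL show "u \<in> G_space M \<Omega> a"
    by (simp add: G_space_iff)
qed

lemma G_space_subset_closure:
  "G_space M \<Omega> a \<subseteq> seminorm_closure L (orlicz_norm M \<Omega>) (test_functions \<Omega>)"
proof
  fix f assume "f \<in> G_space M \<Omega> a"
  then have fL: "f \<in> L" and lim: "((\<lambda>\<delta>. lnorm (\<lambda>x. shift \<Omega> a \<delta> f x - f x)) \<longlongrightarrow> 0) (at 0)"
    by (simp_all add: G_space_iff)
  have [measurable]: "f \<in> X"
    using fL by (simp add: orlicz_space_iff)
  have "\<exists>\<phi>\<in>test_functions \<Omega>. orlicz_norm M \<Omega> (\<lambda>x. f x - \<phi> x) < ennreal \<epsilon>" if \<epsilon>: "\<epsilon> > 0" for \<epsilon> :: real
  proof -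
    have \<epsilon>2: "\<epsilon>/2 > 0"
      using \<epsilon> by simp
    obtain g B where g[measurable]: "g \<in> X" and B: "\<And>x. cmod (g x) \<le> B" and fg: "lnorm (\<lambda>x. f x - g x) \<le> ennreal (\<epsilon>/2)"
      using bounded_approximation[OF fL lim \<epsilon>2] by blast
    have "smooth_approximable g"
      using B by (rule smooth_approximable_bounded[OF g])
    then obtain \<phi> where \<phi>: "\<phi> \<in> test_functions \<Omega>" "lnorm (\<lambda>x. g x - \<phi> x) < ennreal (\<epsilon>/2)"
      using \<epsilon>2 by (rule smooth_approximableE)
    note [measurable] = test_function_measurable[OF \<phi>(1)]
    have "orlicz_norm M \<Omega> (\<lambda>x. f x - \<phi> x) \<le> lnorm (\<lambda>x. f x - \<phi> x)"
      by (rule orlicz_norm_le_abs)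
    also have "\<dots> \<le> lnorm (\<lambda>x. f x - g x) + lnorm (\<lambda>x. g x - \<phi> x)"
      by (rule abs_orlicz_norm_add) (auto intro: norm_diff_triangle_le)
    also have "\<dots> < ennreal (\<epsilon>/2) + ennreal (\<epsilon>/2)"
      by (rule ennreal_add_le_less[OF fg \<phi>(2)])
    also have "\<dots> = ennreal \<epsilon>"
      using \<epsilon> by (simp flip: ennreal_plus)
    finally show ?thesis
      using \<phi>(1) by blast
  qed
  with fL show "f \<in> seminorm_closure L (orlicz_norm M \<Omega>) (test_functions \<Omega>)"
    by (simp add: seminorm_closure_def)
qed

end

theorem lemma2p3:
  fixes M :: "real \<Rightarrow> real" and \<Omega> :: "(real^'n) set" and a :: "real^'n"
  assumes "N_function M"
    and "open \<Omega>" and "connected \<Omega>" and "\<Omega> \<noteq> {}" and "bounded \<Omega>"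
    and "\<Omega> \<subseteq> cbox a (a + vec (diameter \<Omega>))"
    and "reflexive_space (orlicz_space M \<Omega>) (orlicz_norm M \<Omega>)"
    and "\<And>\<epsilon>::real. \<epsilon> > 0 \<Longrightarrow> \<exists>\<eta>>0. \<forall>E \<in> sets lebesgue. E \<subseteq> \<Omega> \<and> measure lebesgue E < \<eta> \<longrightarrow>
           orlicz_norm M \<Omega> (indicator E) < ennreal \<epsilon>"
  shows "seminorm_closure (orlicz_space M \<Omega>) (orlicz_norm M \<Omega>) (test_functions \<Omega>) = G_space M \<Omega> a"
proof -
  obtain x r where "r > 0" "ball x r \<subseteq> \<Omega>"
    using assms(2,4) open_contains_ball by blast
  then have "diameter \<Omega> > 0"
    using diameter_subset[OF \<open>ball x r \<subseteq> \<Omega>\<close> assms(5)] diameter_ball[of x r] by simp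
  moreover have "\<Omega> \<subseteq> cell a (diameter \<Omega>)"
  proof -
    \<comment> \<open>An open subset of the closed cube lies in its interior and misses the upper
      faces, where the half-open cell and the closed cube differ.\<close>
    have "\<Omega> \<subseteq> interior (cbox a (a + vec (diameter \<Omega>)))"
      by (intro interior_maximal assms)
    also have "\<dots> \<subseteq> cell a (diameter \<Omega>)"
      by (auto simp: interior_cbox cell_def mem_box_cart less_imp_le)
    finally show ?thesis .
  qed
  ultimately interpret orlicz_cell_ac M \<Omega> a
    using assms by unfold_locales
  show ?thesis
    using closure_test_functions_subset G_space_subset_closure by (rule antisym)
qed

end
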